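(* Let $V$ be a finite-dimensional irreducible $U^{\geq 0}$-module of type $\alpha$, and let $\varepsilon_0,\varepsilon_1\in\{1,-1\}$. Then there exists a unique $U_q(\widehat{\mathfrak{sl}}_2)$-module structure on $V$ such that the operators $e_0^+-R$, $e_1^+-L$, $K_0^{\pm1}-\varepsilon_0\alpha^{\mp1}K^{\pm1}$ and $K_1^{\pm1}-\varepsilon_1\alpha^{\pm1}K^{\mp1}$ vanish on $V$ (that is, $e_0^+=R$, $e_1^+=L$, $K_0=\varepsilon_0\alpha^{-1}K$, $K_0^{-1}=\varepsilon_0\alpha K^{-1}$, $K_1=\varepsilon_1\alpha K^{-1}$, $K_1^{-1}=\varepsilon_1\alpha^{-1}K$ as operators on $V$). This $U_q(\widehat{\mathfrak{sl}}_2)$-module structure is irreducible and of type $(\varepsilon_0,\varepsilon_1)$.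
   Context: $\mathbb F$ is an algebraically closed field, and $q\in\mathbb F$ is nonzero and not a root of unity. $[n]=\frac{q^n-q^{-n}}{q-q^{-1}}$. $U_q(\widehat{\mathfrak{sl}}_2)$ is the unital associative $\mathbb F$-algebra with generators $e_i^{\pm},K_i^{\pm1}$ ($i\in\{0,1\}$) and relations: $K_iK_i^{-1}=K_i^{-1}K_i=1$; $K_0K_1=K_1K_0$; $K_ie_i^{\pm}K_i^{-1}=q^{\pm2}e_i^{\pm}$; $K_ie_j^{\pm}K_i^{-1}=q^{\mp2}e_j^{\pm}$ for $i\ne j$; $[e_i^+,e_i^-]=\frac{K_i-K_i^{-1}}{q-q^{-1}}$; $[e_0^{\pm},e_1^{\mp}]=0$; $(e_i^{\pm})^3e_j^{\pm}-[3](e_i^{\pm})^2e_j^{\pm}e_i^{\pm}+[3]e_i^{\pm}e_j^{\pm}(e_i^{\pm})^2-e_j^{\pm}(e_i^{\pm})^3=0$ for $i\neq j$. (Here $[x,y]=xy-yx$ for algebra elements.) $U^{\geq0}$ is the unital associative $\mathbb F$-algebra with generators $R,L,K^{\pm1}$ and relations: $KK^{-1}=K^{-1}K=1$; $KRK^{-1}=q^2R$; $KLK^{-1}=q^{-2}L$; $R^3L-[3]R^2LR+[3]RLR^2-LR^3=0$; $L^3R-[3]L^2RL+[3]LRL^2-RL^3=0$. Type of a $U^{\geq0}$-module: on any finite-dimensional irreducible $U^{\geq0}$-module $V$, $K$ acts semisimply and there are a unique integer $d\ge0$ and a unique nonzero $\alpha\in\mathbb F$ such that the set of distinct eigenvalues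 of $K$ on $V$ is $\{\alpha q^{2i-d}\mid 0\le i\le d\}$; $\alpha$ is called the type of $V$. Type of a $U_q(\widehat{\mathfrak{sl}}_2)$-module: on any finite-dimensional irreducible $U_q(\widehat{\mathfrak{sl}}_2)$-module $V$, it is known that $K_0,K_1$ act semisimply and there are an integer $d\ge0$ and $\varepsilon_0,\varepsilon_1\in\{1,-1\}$ such that the set of distinct eigenvalues of $K_0$ on $V$ is $\{\varepsilon_0q^{2i-d}\mid 0\le i\le d\}$ and $K_0K_1-\varepsilon_0\varepsilon_1I$ vanishes on $V$; the pair $(\varepsilon_0,\varepsilon_1)$ is called the type of $V$. (If $\mathbb F$ has characteristic 2, $\{1,-1\}$ is viewed as having a single element.) *)

theory Defs
  imports
    "HOL-Algebra.QuotRing"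
    "HOL-Algebra.Algebraic_Closure_Type"
    "HOL-Library.Poly_Mapping"
    "HOL-Computational_Algebra.Polynomial"
begin

section \<open>Algebras presented by generators and relations\<close>

text \<open>
  The free monoid is the type of lists, written additively: this is the form of exponents from which
  \<^type>\<open>poly_mapping\<close> builds the convolution product. So the type \<open>free_algebra\<close>
  below, with its type class operations, is the free unital associative algebra.
\<close>

datatype 'g free_monoid = Word (letters: "'g list")

instantiation free_monoid :: (type) monoid_add
begin

definition zero_free_monoid :: "'a free_monoid"
  where "0 = Word []"

definition plus_free_monoid :: "'a free_monoid \<Rightarrow> 'a free_monoid \<Rightarrow> 'a free_monoid"
  where "v + w = Word (letters v @ letters w)"

instance
  by standard (simp_all add: zero_free_monoid_def plus_free_monoid_def)

end

type_synonym ('g, 'f) free_algebra = "'g free_monoid \<Rightarrow>\<^sub>0 'f"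

definition fgen :: "'g \<Rightarrow> ('g, 'f::field) free_algebra"
  where "fgen g = Poly_Mapping.single (Word [g]) 1"

definition fconst :: "'f::field \<Rightarrow> ('g, 'f) free_algebra"
  where "fconst c = Poly_Mapping.single 0 c"

text \<open>
  Relations \<open>x = y\<close> are given as elements \<open>x - y\<close>. In HOL-Algebra, ideals are
  two-sided, so the quotient below is the presented algebra also in the noncommutative case.
\<close>

definition rel_ideal :: "('g, 'f::field) free_algebra set \<Rightarrow> ('g, 'f) free_algebra set"
  where "rel_ideal Rel = genideal ring_of_type_algebra Rel"

definition presented :: "('g, 'f::field) free_algebra set \<Rightarrow> ('g, 'f) free_algebra set ring"
  where "presented Rel = ring_of_type_algebra Quot rel_ideal Rel"

definition coset_of ::
    "('g, 'f::field) free_algebra set \<Rightarrow> ('g, 'f) free_algebra \<Rightarrow> ('g, 'f) free_algebra set"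
  where "coset_of Rel x = rel_ideal Rel +>\<^bsub>ring_of_type_algebra\<^esub> x"

abbreviation pgen :: "('g, 'f::field) free_algebra set \<Rightarrow> 'g \<Rightarrow> ('g, 'f) free_algebra set"
  where "pgen Rel g \<equiv> coset_of Rel (fgen g)"

abbreviation pconst :: "('g, 'f::field) free_algebra set \<Rightarrow> 'f \<Rightarrow> ('g, 'f) free_algebra set"
  where "pconst Rel c \<equiv> coset_of Rel (fconst c)"


section \<open>Modules\<close>

text \<open>
  Left unital module structures over the algebra \<open>presented Rel\<close> on the vector space that
  is the whole type \<open>'v\<close>. The last assumption fixes the value of \<open>act\<close> outside the
  algebra, so that two module structures are equal iff they agree on the algebra.
\<close>

locale presented_module = vector_space scale
  for scale :: "'f::field \<Rightarrow> 'v::ab_group_add \<Rightarrow> 'v" +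
  fixes Rel :: "('g, 'f) free_algebra set"
    and act :: "('g, 'f) free_algebra set \<Rightarrow> 'v \<Rightarrow> 'v"
  assumes act_linear: "a \<in> carrier (presented Rel) \<Longrightarrow> Vector_Spaces.linear scale scale (act a)"
    and act_add: "a \<in> carrier (presented Rel) \<Longrightarrow> b \<in> carrier (presented Rel) \<Longrightarrow>
      act (a \<oplus>\<^bsub>presented Rel\<^esub> b) v = act a v + act b v"
    and act_scale: "a \<in> carrier (presented Rel) \<Longrightarrow>
      act (pconst Rel c \<otimes>\<^bsub>presented Rel\<^esub> a) v = scale c (act a v)"
    and act_mult: "a \<in> carrier (presented Rel) \<Longrightarrow> b \<in> carrier (presented Rel) \<Longrightarrow>
      act (a \<otimes>\<^bsub>presented Rel\<^esub> b) v = act a (act b v)"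
    and act_one: "act \<one>\<^bsub>presented Rel\<^esub> v = v"
    and act_extensional: "act \<in> extensional (carrier (presented Rel))"

definition irreducible_module ::
    "('f::field \<Rightarrow> 'v::ab_group_add \<Rightarrow> 'v) \<Rightarrow> ('g, 'f) free_algebra set \<Rightarrow>
      (('g, 'f) free_algebra set \<Rightarrow> 'v \<Rightarrow> 'v) \<Rightarrow> bool"
  where "irreducible_module scale Rel act \<longleftrightarrow>
    presented_module scale Rel act \<and> (UNIV :: 'v set) \<noteq> {0} \<and>
    (\<forall>W. module.subspace scale W \<and> (\<forall>a\<in>carrier (presented Rel). act a ` W \<subseteq> W)
      \<longrightarrow> W = {0} \<or> W = UNIV)"

definition eigenvalues :: "('f::field \<Rightarrow> 'v::ab_group_add \<Rightarrow> 'v) \<Rightarrow> ('v \<Rightarrow> 'v) \<Rightarrow> 'f set"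
  where "eigenvalues scale T = {c. \<exists>v. v \<noteq> 0 \<and> T v = scale c v}"


section \<open>The two algebras\<close>

definition qbracket :: "'f::field \<Rightarrow> int \<Rightarrow> 'f"
  where "qbracket q n = (q powi n - q powi (- n)) / (q - inverse q)"

definition comm :: "'a::ring \<Rightarrow> 'a \<Rightarrow> 'a"
  where "comm x y = x * y - y * x"

definition q_serre :: "'f::field \<Rightarrow> ('g, 'f) free_algebra \<Rightarrow> ('g, 'f) free_algebra \<Rightarrow> ('g, 'f) free_algebra"
  where "q_serre q x y =
    x ^ 3 * y - fconst (qbracket q 3) * x ^ 2 * y * x
      + fconst (qbracket q 3) * x * y * x ^ 2 - y * x ^ 3"

datatype uge0_gen = R | L | K | Kinv

definition uge0_rels :: "'f::field \<Rightarrow> (uge0_gen, 'f) free_algebra set"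
  where "uge0_rels q =
    {fgen K * fgen Kinv - 1,
     fgen Kinv * fgen K - 1,
     fgen K * fgen R * fgen Kinv - fconst (q powi 2) * fgen R,
     fgen K * fgen L * fgen Kinv - fconst (q powi (- 2)) * fgen L,
     q_serre q (fgen R) (fgen L),
     q_serre q (fgen L) (fgen R)}"

text \<open>
  The constructor \<open>E s i\<close> stands for \<open>e\<^sub>i\<^sup>+\<close> or
  \<open>e\<^sub>i\<^sup>-\<close>, according to \<open>s\<close>.
\<close>

datatype node = Node0 | Node1

datatype sign = Pos | Neg

fun sign_int :: "sign \<Rightarrow> int"
  where "sign_int Pos = 1" | "sign_int Neg = - 1"

datatype uq_gen = E sign node | KK node | KKinv node

definition uq_rels :: "'f::field \<Rightarrow> (uq_gen, 'f) free_algebra set"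
  where "uq_rels q =
    {fgen (KK i) * fgen (KKinv i) - 1 | i. True} \<union>
    {fgen (KKinv i) * fgen (KK i) - 1 | i. True} \<union>
    {fgen (KK Node0) * fgen (KK Node1) - fgen (KK Node1) * fgen (KK Node0)} \<union>
    {fgen (KK i) * fgen (E s i) * fgen (KKinv i)
       - fconst (q powi (2 * sign_int s)) * fgen (E s i) | i s. True} \<union>
    {fgen (KK i) * fgen (E s j) * fgen (KKinv i)
       - fconst (q powi (- 2 * sign_int s)) * fgen (E s j) | i j s. i \<noteq> j} \<union>
    {comm (fgen (E Pos i)) (fgen (E Neg i))
       - fconst (inverse (q - inverse q)) * (fgen (KK i) - fgen (KKinv i)) | i. True} \<union>
    {comm (fgen (E Pos Node0)) (fgen (E Neg Node1)),
     comm (fgen (E Neg Node0)) (fgen (E Pos Node1))} \<union>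
    {q_serre q (fgen (E s i)) (fgen (E s j)) | i j s. i \<noteq> j}"


section \<open>Types of modules\<close>

definition uge0_type ::
    "'f::field \<Rightarrow> ('f \<Rightarrow> 'v::ab_group_add \<Rightarrow> 'v) \<Rightarrow>
      ((uge0_gen, 'f) free_algebra set \<Rightarrow> 'v \<Rightarrow> 'v) \<Rightarrow> 'f \<Rightarrow> bool"
  where "uge0_type q scale act \<alpha> \<longleftrightarrow>
    \<alpha> \<noteq> 0 \<and>
    (\<exists>d::nat. eigenvalues scale (act (pgen (uge0_rels q) K))
       = {\<alpha> * q powi (2 * int i - int d) | i. i \<le> d})"

definition uq_type ::
    "'f::field \<Rightarrow> ('f \<Rightarrow> 'v::ab_group_add \<Rightarrow> 'v) \<Rightarrow>
      ((uq_gen, 'f) free_algebra set \<Rightarrow> 'v \<Rightarrow> 'v) \<Rightarrow> 'f \<Rightarrow> 'f \<Rightarrow> bool"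
  where "uq_type q scale act \<epsilon>\<^sub>0 \<epsilon>\<^sub>1 \<longleftrightarrow>
    \<epsilon>\<^sub>0 \<in> {1, - 1} \<and> \<epsilon>\<^sub>1 \<in> {1, - 1} \<and>
    (\<exists>d::nat. eigenvalues scale (act (pgen (uq_rels q) (KK Node0)))
       = {\<epsilon>\<^sub>0 * q powi (2 * int i - int d) | i. i \<le> d}) \<and>
    (\<forall>v. act (pgen (uq_rels q) (KK Node0)) (act (pgen (uq_rels q) (KK Node1)) v)
       = scale (\<epsilon>\<^sub>0 * \<epsilon>\<^sub>1) v)"

definition uq_extends ::
    "'f::field \<Rightarrow> ('f \<Rightarrow> 'v::ab_group_add \<Rightarrow> 'v) \<Rightarrow>
      ((uge0_gen, 'f) free_algebra set \<Rightarrow> 'v \<Rightarrow> 'v) \<Rightarrow> 'f \<Rightarrow> 'f \<Rightarrow> 'f \<Rightarrow>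
      ((uq_gen, 'f) free_algebra set \<Rightarrow> 'v \<Rightarrow> 'v) \<Rightarrow> bool"
  where "uq_extends q scale act \<alpha> \<epsilon>\<^sub>0 \<epsilon>\<^sub>1 act' \<longleftrightarrow>
    presented_module scale (uq_rels q) act' \<and>
    (\<forall>v.
      act' (pgen (uq_rels q) (E Pos Node0)) v = act (pgen (uge0_rels q) R) v \<and>
      act' (pgen (uq_rels q) (E Pos Node1)) v = act (pgen (uge0_rels q) L) v \<and>
      act' (pgen (uq_rels q) (KK Node0)) v
        = scale (\<epsilon>\<^sub>0 * inverse \<alpha>) (act (pgen (uge0_rels q) K) v) \<and>
      act' (pgen (uq_rels q) (KKinv Node0)) v
        = scale (\<epsilon>\<^sub>0 * \<alpha>) (act (pgen (uge0_rels q) Kinv) v) \<and>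
      act' (pgen (uq_rels q) (KK Node1)) v
        = scale (\<epsilon>\<^sub>1 * \<alpha>) (act (pgen (uge0_rels q) Kinv) v) \<and>
      act' (pgen (uq_rels q) (KKinv Node1)) v
        = scale (\<epsilon>\<^sub>1 * inverse \<alpha>) (act (pgen (uge0_rels q) K) v))"

end

theory Submission
  imports Defs
begin

text \<open>
  After rescaling \<open>K\<close> by \<open>\<alpha>\<^sup>-\<^sup>1\<close>, let \<open>k\<close>, \<open>x\<close>, \<open>y\<close> be the operators of
  \<open>K\<close>, \<open>R\<close>, \<open>L\<close> on \<open>V\<close>; the eigenvalues of \<open>k\<close> are \<open>th i = q powi (2 * i - d)\<close> for
  \<open>0 \<le> i \<le> d\<close>. By irreducibility \<open>V\<close> is the sum of the eigenspaces of \<open>k\<close>; the operator \<open>x\<close>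
  raises and \<open>y\<close> lowers the index of an eigenspace by one.

  The heart of the matter is to construct an operator \<open>r\<close> (which becomes \<open>e\<^sub>0\<^sup>-\<close> up to sign) that
  lowers the index, satisfies
  \<open>x r - r x = (k - k\<^sup>-\<^sup>1) / (q - q\<^sup>-\<^sup>1)\<close>, and commutes with \<open>y\<close>. Put \<open>A = k + x\<close>. It is
  diagonalizable with the same eigenvalues \<open>th i\<close> as \<open>k\<close>. The q-Serre relation remains valid when
  \<open>x\<close> is replaced by \<open>A\<close> (\<open>serre_add_weight\<close>), and so \<open>y\<close> moves the index of an eigenspace of \<open>A\<close>
  by at most one; also \<open>A k\<^sup>-\<^sup>1 - q\<^sup>2 k\<^sup>-\<^sup>1 A = 1 - q\<^sup>2\<close>, and so \<open>k\<^sup>-\<^sup>1\<close> maps the eigenspace of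
  index \<open>j\<close> into those of index \<open>j\<close> and \<open>j + 1\<close>. Let \<open>U i\<close> and \<open>U' j\<close> be the sums of the eigenspaces of
  \<open>k\<close> and of \<open>A\<close> with index at most \<open>i\<close> and at most \<open>j\<close>. Then for each \<open>m\<close> the sum over \<open>i\<close> of
  the spaces \<open>U i \<inter> U' (m - i)\<close> is invariant under \<open>A\<close>, \<open>k\<^sup>-\<^sup>1\<close> and \<open>y\<close>, hence a submodule
  (\<open>pieces_dichotomy\<close>). For \<open>m = d - 1\<close> it is contained in \<open>U (d - 1)\<close>, which is not \<open>V\<close>, so it is zero;
  for \<open>m = d\<close> it contains \<open>U 0 \<noteq> 0\<close>, so it is \<open>V\<close>. Together these say that \<open>V\<close> is the direct sum of the
  spaces \<open>W i = U i \<inter> U' (d - i)\<close>.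

  On \<open>W i\<close> the operators \<open>A - th (d - i)\<close>, \<open>k\<^sup>-\<^sup>1 - th (d - i)\<close> and \<open>y\<close> map into \<open>W (i + 1)\<close>,
  \<open>W (i - 1)\<close> and \<open>W (i - 1)\<close>. Therefore the operator \<open>B\<close> that acts on each \<open>W i\<close> as \<open>th i\<close> satisfies
  simple q-commutation relations with \<open>A\<close>, \<open>k\<^sup>-\<^sup>1\<close> and \<open>y\<close>, and these say exactly that a scalar multiple
  \<open>r\<close> of \<open>(B - k) k\<^sup>-\<^sup>1\<close> has the required properties (\<open>exists_lowering_partner\<close>). Exchanging \<open>x\<close> with \<open>y\<close>
  and \<open>k\<close> with \<open>k\<^sup>-\<^sup>1\<close> gives the operator \<open>l\<close> for \<open>e\<^sub>1\<^sup>-\<close>.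

  Everything else follows from one observation (\<open>commuting_weight_shift_zero\<close>): an operator that commutes
  with \<open>x\<close> and \<open>y\<close> and shifts the eigenspaces of \<open>k\<close> by a fixed nonzero amount has an invariant nonzero
  kernel and therefore vanishes. This applies to the difference of two candidates for \<open>r\<close> or \<open>l\<close>, which gives
  uniqueness, and to the two q-Serre expressions in \<open>r\<close> and \<open>l\<close>, which gives the remaining defining
  relations. The extended module is irreducible since its operators include \<open>k\<close>, \<open>k\<^sup>-\<^sup>1\<close>, \<open>x\<close>, \<open>y\<close> up to sign,
  and its type is read off from \<open>K\<^sub>0 = \<epsilon>\<^sub>0 k\<close> and \<open>K\<^sub>1 = \<epsilon>\<^sub>1 k\<^sup>-\<^sup>1\<close>.
\<close>

section \<open>The ring of endomorphisms of an abelian group\<close>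

text \<open>
  The additive endomorphisms of an abelian group. Bundled into a type they form a ring, so that operator
  identities can be proved by rewriting in a ring instead of pointwise. The type is not an
  instance of \<open>ring_1\<close>, since \<open>0 = 1\<close> if the group is trivial.
\<close>

typedef (overloaded) ('v::ab_group_add) add_end = "{f :: 'v \<Rightarrow> 'v. \<forall>v w. f (v + w) = f v + f w}"
  morphisms app Add_End
  by (rule exI[of _ id]) simp

setup_lifting type_definition_add_end

lemma app_add: "app f (v + w) = app f v + app f w"
  by transfer simp

lemma add_end_eqI: "(\<And>v. app f v = app g v) \<Longrightarrow> f = g"
  by transfer auto

lemma app_Add_End: "(\<And>v w. f (v + w) = f v + f w) \<Longrightarrow> app (Add_End f) = f"
  by (simp add: Add_End_inverse)

instantiation add_end :: (ab_group_add) "{ring, monoid_mult}"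
begin

lift_definition zero_add_end :: "'a add_end" is "\<lambda>v. 0" by simp
lift_definition one_add_end :: "'a add_end" is "\<lambda>v. v" by simp
lift_definition plus_add_end :: "'a add_end \<Rightarrow> 'a add_end \<Rightarrow> 'a add_end"
  is "\<lambda>f g v. f v + g v" by (simp add: algebra_simps)
lift_definition minus_add_end :: "'a add_end \<Rightarrow> 'a add_end \<Rightarrow> 'a add_end"
  is "\<lambda>f g v. f v - g v" by (simp add: algebra_simps)
lift_definition uminus_add_end :: "'a add_end \<Rightarrow> 'a add_end"
  is "\<lambda>f v. - f v" by (simp add: algebra_simps)
lift_definition times_add_end :: "'a add_end \<Rightarrow> 'a add_end \<Rightarrow> 'a add_end"
  is "\<lambda>f g v. f (g v)" by simp

instance
  by standard (transfer; simp add: fun_eq_iff algebra_simps)+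

end

lemma app_simps [simp]:
  "app 0 v = 0" "app 1 v = v" "app (f + g) v = app f v + app g v"
  "app (f - g) v = app f v - app g v" "app (- f) v = - app f v"
  "app (f * g) v = app f (app g v)"
  by (transfer; simp)+

lemma app_zero [simp]: "app f 0 = 0"
  using app_add[of f 0 0] by simp

lemma app_minus: "app f (- v) = - app f v"
  using app_add[of f v "- v"] by (simp add: eq_neg_iff_add_eq_0 add.commute)

lemma app_diff: "app f (v - w) = app f v - app f w"
  using app_add[of f v "- w"] by (simp add: app_minus)

text \<open>
  In a vector space, \<open>sc c\<close> is the multiplication by the scalar \<open>c\<close>, and an endomorphism is linear
  iff it commutes with all \<open>sc c\<close>.
\<close>

locale operators = vector_space scale
  for scale :: "'f::field \<Rightarrow> 'v::ab_group_add \<Rightarrow> 'v"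
begin

definition sc :: "'f \<Rightarrow> 'v add_end"
  where "sc c = Add_End (scale c)"

definition lin :: "'v add_end \<Rightarrow> bool"
  where "lin f \<longleftrightarrow> (\<forall>c. f * sc c = sc c * f)"

lemma app_sc [simp]: "app (sc c) v = scale c v"
  by (simp add: sc_def app_Add_End scale_right_distrib)

lemma sc_simps: "sc 0 = 0" "sc 1 = 1" "sc (a + b) = sc a + sc b" "sc (a - b) = sc a - sc b"
    "sc (- a) = - sc a" "sc (a * b) = sc a * sc b"
  by (rule add_end_eqI; simp add: algebra_simps)+

lemma lin_iff: "lin f \<longleftrightarrow> (\<forall>c v. app f (scale c v) = scale c (app f v))"
proof -
  have "f * sc c = sc c * f \<longleftrightarrow> (\<forall>v. app f (scale c v) = scale c (app f v))" for c
    by (metis (no_types) add_end_eqI app_sc app_simps(6))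
  then show ?thesis by (simp add: lin_def)
qed

lemma lin_scale: "lin f \<Longrightarrow> app f (scale c v) = scale c (app f v)"
  by (simp add: lin_iff)

lemma lin_simps [intro, simp]:
  "lin 0" "lin 1" "lin (sc c)" "lin f \<Longrightarrow> lin g \<Longrightarrow> lin (f + g)" "lin f \<Longrightarrow> lin g \<Longrightarrow> lin (f - g)"
  "lin f \<Longrightarrow> lin (- f)" "lin f \<Longrightarrow> lin g \<Longrightarrow> lin (f * g)" "lin f \<Longrightarrow> lin (f ^ n)"
proof -
  show "lin f \<Longrightarrow> lin g \<Longrightarrow> lin (f * g)" for f g by (simp add: lin_iff)
  then show "lin f \<Longrightarrow> lin (f ^ n)" by (induction n) (simp_all add: lin_iff)
qed (simp_all add: lin_iff algebra_simps)

lemma linear_app: "lin f \<longleftrightarrow> Vector_Spaces.linear scale scale (app f)"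
  by (auto simp: lin_iff Vector_Spaces.linear_iff app_add vector_space_axioms)

lemma subspace_app_vimage: "lin f \<Longrightarrow> subspace W \<Longrightarrow> subspace {v. app f v \<in> W}"
  by (auto simp: subspace_def app_add lin_scale)

lemma subspace_kernel: "lin f \<Longrightarrow> subspace {v. app f v = 0}"
  by (auto simp: subspace_def app_add lin_scale)

lemma app_span: "lin f \<Longrightarrow> (\<And>v. v \<in> S \<Longrightarrow> app f v \<in> W) \<Longrightarrow> subspace W \<Longrightarrow> v \<in> span S \<Longrightarrow> app f v \<in> W"
  using span_minimal[of S "{v. app f v \<in> W}"] subspace_app_vimage[of f W] by auto

lemma app_eq_on_span:
  "lin f \<Longrightarrow> lin g \<Longrightarrow> (\<And>v. v \<in> S \<Longrightarrow> app f v = app g v) \<Longrightarrow> v \<in> span S \<Longrightarrow> app f v = app g v"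
  using span_minimal[of S "{v. app (f - g) v = 0}"] subspace_kernel[of "f - g"] by auto

end

section \<open>Modules over presented algebras as tuples of operators\<close>

text \<open>The ring of a type class algebra need not be commutative; here it is a free algebra.\<close>

lemma ring_ring_of_type_algebra: "ring (ring_of_type_algebra :: 'a::ring_1 ring)"
proof (intro ringI abelian_groupI monoidI)
  show "\<exists>y\<in>carrier ring_of_type_algebra. y \<oplus>\<^bsub>ring_of_type_algebra\<^esub> x = \<zero>\<^bsub>ring_of_type_algebra\<^esub>" for x :: 'a
    by (rule bexI[of _ "- x"]) (simp_all add: ring_of_type_algebra_def)
qed (simp_all add: ring_of_type_algebra_def algebra_simps)

lemma ideal_rel_ideal: "ideal (rel_ideal Rel) (ring_of_type_algebra :: ('g, 'f::field) free_algebra ring)"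
  unfolding rel_ideal_def
  by (rule ring.genideal_ideal[OF ring_ring_of_type_algebra]) (simp add: ring_of_type_algebra_def)

lemma carrier_presented: "carrier (presented Rel) = range (coset_of Rel)"
  by (auto simp: presented_def FactRing_def A_RCOSETS_def' coset_of_def ring_of_type_algebra_def a_r_coset_def)

lemma coset_of_in_carrier [simp]: "coset_of Rel x \<in> carrier (presented Rel)"
  by (simp add: carrier_presented)

lemma coset_of_hom: "coset_of Rel \<in> ring_hom ring_of_type_algebra (presented Rel)"
  using ideal.rcos_ring_hom[OF ideal_rel_ideal, of Rel]
  by (simp add: presented_def coset_of_def[abs_def])

lemma coset_of_add: "coset_of Rel x \<oplus>\<^bsub>presented Rel\<^esub> coset_of Rel y = coset_of Rel (x + y)"
  using ring_hom_add[OF coset_of_hom, of x y Rel] by (simp add: ring_of_type_algebra_def)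

lemma coset_of_mult: "coset_of Rel x \<otimes>\<^bsub>presented Rel\<^esub> coset_of Rel y = coset_of Rel (x * y)"
  using ring_hom_mult[OF coset_of_hom, of x y Rel] by (simp add: ring_of_type_algebra_def)

lemma one_presented: "\<one>\<^bsub>presented Rel\<^esub> = coset_of Rel 1"
  using ring_hom_one[OF coset_of_hom, of Rel] by (simp add: ring_of_type_algebra_def)

lemma mem_coset_of: "z \<in> coset_of Rel x \<longleftrightarrow> (\<exists>h\<in>rel_ideal Rel. z = h + x)"
  by (auto simp: coset_of_def a_r_coset_def r_coset_def ring_of_type_algebra_def)

lemma zero_in_rel_ideal: "0 \<in> rel_ideal Rel"
  using additive_subgroup.zero_closed[OF ideal.axioms(1)[OF ideal_rel_ideal], of Rel]
  by (simp add: ring_of_type_algebra_def)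

lemma coset_of_eqD: "coset_of Rel x = coset_of Rel y \<Longrightarrow> \<exists>h\<in>rel_ideal Rel. x = h + y"
  using zero_in_rel_ideal[of Rel] by (metis add_0 mem_coset_of)

lemma coset_of_rel: "x \<in> Rel \<Longrightarrow> coset_of Rel x = coset_of Rel 0"
proof -
  assume "x \<in> Rel"
  then have "x \<in> rel_ideal Rel"
    unfolding rel_ideal_def
    using ring.genideal_self[OF ring_ring_of_type_algebra, of Rel] by (auto simp: ring_of_type_algebra_def)
  then have "rel_ideal Rel +>\<^bsub>ring_of_type_algebra\<^esub> x = rel_ideal Rel"
    using abelian_subgroup.a_rcos_const
      [OF abelian_subgroupI3[OF ideal.axioms(1)[OF ideal_rel_ideal[of Rel]] ring.is_abelian_group[OF ring_ring_of_type_algebra]]]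
    by simp
  moreover have "rel_ideal Rel +>\<^bsub>ring_of_type_algebra\<^esub> 0 = rel_ideal Rel"
    by (auto simp: a_r_coset_def r_coset_def ring_of_type_algebra_def)
  ultimately show ?thesis by (simp add: coset_of_def)
qed

lemma rel_ideal_minimal:
  assumes "ideal J ring_of_type_algebra" "Rel \<subseteq> J"
  shows "rel_ideal Rel \<subseteq> J"
  unfolding rel_ideal_def using ring.genideal_minimal[OF ring_ring_of_type_algebra assms] .

lemma free_algebra_single_induct:
  fixes x :: "('g, 'f::field) free_algebra"
  assumes "\<And>w c. P (Poly_Mapping.single w c)" "\<And>x y. P x \<Longrightarrow> P y \<Longrightarrow> P (x + y)"
  shows "P x"
proof -
  have "P (\<Sum>w\<in>S. Poly_Mapping.single w (Poly_Mapping.lookup x w))" if "finite S" for S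
    using that
  proof (induction S rule: finite_induct)
    case empty
    then show ?case using assms(1)[of 0 0] by simp
  qed (use assms in auto)
  moreover have "(\<Sum>w\<in>Poly_Mapping.keys x. Poly_Mapping.single w (Poly_Mapping.lookup x w)) = x"
    by (rule poly_mapping_eqI)
      (auto simp: lookup_sum lookup_single when_def in_keys_iff sum.delta)
  ultimately show ?thesis by (metis finite_keys)
qed

lemma free_algebra_induct [case_names const gen add mult]:
  fixes x :: "('g, 'f::field) free_algebra"
  assumes const: "\<And>c. P (fconst c)" and gen: "\<And>g. P (fgen g)"
    and add: "\<And>x y. P x \<Longrightarrow> P y \<Longrightarrow> P (x + y)" and mult: "\<And>x y. P x \<Longrightarrow> P y \<Longrightarrow> P (x * y)"
  shows "P x"
proof (rule free_algebra_single_induct)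
  show "P (x + y)" if "P x" "P y" for x y using that by (rule add)
  fix w :: "'g free_monoid" and c :: 'f
  have "P (Poly_Mapping.single (Word gs) c)" for gs
  proof (induction gs)
    case Nil
    then show ?case using const[of c] by (simp add: fconst_def zero_free_monoid_def)
  next
    case (Cons g gs)
    have "Poly_Mapping.single (Word (g # gs)) c = fgen g * Poly_Mapping.single (Word gs) c"
      by (simp add: fgen_def mult_single plus_free_monoid_def)
    then show ?case using mult[OF gen Cons] by simp
  qed
  then show "P (Poly_Mapping.single w c)" by (cases w) simp
qed

context operators
begin

text \<open>
  Evaluation of elements of the free algebra: each generator \<open>g\<close> becomes \<open>f g\<close> and each constant a scalar
  multiplication. Evaluation is additive for all \<open>f\<close>; it is multiplicative if all \<open>f g\<close> are linear.
\<close>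

definition eval :: "('g \<Rightarrow> 'v add_end) \<Rightarrow> ('g, 'f) free_algebra \<Rightarrow> 'v add_end"
  where "eval f x = (\<Sum>w\<in>Poly_Mapping.keys x. sc (Poly_Mapping.lookup x w) * prod_list (map f (letters w)))"

lemma eval_superset:
  assumes "finite S" "Poly_Mapping.keys x \<subseteq> S"
  shows "eval f x = (\<Sum>w\<in>S. sc (Poly_Mapping.lookup x w) * prod_list (map f (letters w)))"
  unfolding eval_def using assms
  by (intro sum.mono_neutral_left) (auto simp: in_keys_iff sc_simps)

lemma eval_single: "eval f (Poly_Mapping.single w c) = sc c * prod_list (map f (letters w))"
  using eval_superset[of "{w}" "Poly_Mapping.single w c" f] by simp

lemma eval_add: "eval f (x + y) = eval f x + eval f y"
proof -
  let ?S = "Poly_Mapping.keys x \<union> Poly_Mapping.keys y"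
  show ?thesis
    using eval_superset[of ?S x f] eval_superset[of ?S y f]
      eval_superset[of ?S "x + y" f] keys_add[of x y]
    by (simp add: lookup_add sc_simps distrib_right sum.distrib)
qed

lemma eval_zero [simp]: "eval f 0 = 0"
  by (simp add: eval_def)

lemma eval_fgen [simp]: "eval f (fgen g) = f g"
  by (simp add: fgen_def eval_single sc_simps)

lemma eval_fconst [simp]: "eval f (fconst c) = sc c"
  by (simp add: fconst_def eval_single zero_free_monoid_def)

lemma eval_one [simp]: "eval f 1 = 1"
  using eval_fconst[of f 1] by (simp add: fconst_def sc_simps single_one)

lemma lin_prod_list: "(\<And>g. g \<in> set gs \<Longrightarrow> lin g) \<Longrightarrow> lin (prod_list gs)"
  by (induction gs) auto

lemma eval_mult:
  assumes "\<And>g. lin (f g)"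
  shows "eval f (x * y) = eval f x * eval f y"
proof (induction x rule: free_algebra_single_induct)
  case (1 v a)
  show ?case
  proof (induction y rule: free_algebra_single_induct)
    case (1 w b)
    have "lin (prod_list (map f (letters v)))" using assms by (intro lin_prod_list) auto
    then have *: "prod_list (map f (letters v)) * (sc b * z) = sc b * (prod_list (map f (letters v)) * z)" for z
      by (simp add: lin_def flip: mult.assoc)
    show ?case
      by (simp add: mult_single eval_single plus_free_monoid_def sc_simps mult.assoc *)
  qed (simp add: distrib_left eval_add)
qed (simp add: distrib_right eval_add)

lemma eval_minus: "eval f (x - y) = eval f x - eval f y"
  using eval_add[of f "x - y" y] by (simp add: eq_diff_eq)

lemma eval_power: "(\<And>g. lin (f g)) \<Longrightarrow> eval f (x ^ n) = eval f x ^ n"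
  by (induction n) (simp_all add: eval_mult)

lemma lin_eval: "(\<And>g. lin (f g)) \<Longrightarrow> lin (eval f x)"
  by (induction x rule: free_algebra_induct) (simp_all add: eval_add eval_mult)

text \<open>
  Linear operators that satisfy the defining relations make the vector space a module: \<open>eval f\<close> is zero on
  the ideal of relations and so is constant on cosets.
\<close>

lemma module_of_operators:
  assumes lin: "\<And>g. lin (f g)" and rel: "\<And>x. x \<in> Rel \<Longrightarrow> eval f x = 0"
  obtains act where "presented_module scale Rel act" "\<And>g v. act (pgen Rel g) v = app (f g) v"
proof -
  define act where "act = (\<lambda>a\<in>carrier (presented Rel). app (eval f (SOME x. a = coset_of Rel x)))"
  have "ideal {x. eval f x = 0} (ring_of_type_algebra :: ('a, 'f) free_algebra ring)"
  proof (rule idealI[OF ring_ring_of_type_algebra])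
    show "subgroup {x. eval f x = 0} (add_monoid ring_of_type_algebra)"
    proof (rule group.subgroupI)
      show "Group.group (add_monoid (ring_of_type_algebra :: ('a, 'f) free_algebra ring))"
        using abelian_group.a_group[OF ring.is_abelian_group[OF ring_ring_of_type_algebra]] .
      fix x :: "('a, 'f) free_algebra"
      assume x: "x \<in> {x. eval f x = 0}"
      have "a_inv ring_of_type_algebra x = - x"
        using abelian_group.minus_equality[OF ring.is_abelian_group[OF ring_ring_of_type_algebra], of "- x" x]
        by (simp add: ring_of_type_algebra_def)
      moreover have "eval f (- x) = 0" using eval_minus[of f 0 x] x by simp
      ultimately show "inv\<^bsub>add_monoid ring_of_type_algebra\<^esub> x \<in> {x. eval f x = 0}"
        by (simp add: a_inv_def)
    qed (auto simp: ring_of_type_algebra_def eval_add intro: exI[of _ 0])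
  qed (auto simp: ring_of_type_algebra_def eval_mult lin)
  then have ideal: "rel_ideal Rel \<subseteq> {x. eval f x = 0}"
    by (rule rel_ideal_minimal) (use rel in auto)
  have act: "act (coset_of Rel x) = app (eval f x)" for x
  proof -
    define y where "y = (SOME y. coset_of Rel x = coset_of Rel y)"
    have "coset_of Rel x = coset_of Rel y" unfolding y_def by (rule someI[of _ x]) simp
    then obtain h where "h \<in> rel_ideal Rel" "x = h + y" using coset_of_eqD by blast
    then have "eval f x = eval f y" using ideal by (auto simp: eval_add)
    then show ?thesis by (simp add: act_def y_def)
  qed
  have "presented_module scale Rel act"
  proof
    show "act \<in> extensional (carrier (presented Rel))" by (simp add: act_def)
  qed (auto simp: carrier_presented act coset_of_add coset_of_mult one_presented eval_add eval_mult
      lin lin_eval app_add lin_scale)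
  then show thesis using that[of act] by (simp add: act)
qed

text \<open>
  The representation of the free algebra on a module over the presented algebra. It has its intended
  meaning only if \<open>act\<close> is a module structure, so that \<open>act\<close> of a coset is additive.
\<close>

definition rep :: "('g, 'f) free_algebra set \<Rightarrow> (('g, 'f) free_algebra set \<Rightarrow> 'v \<Rightarrow> 'v) \<Rightarrow>
    ('g, 'f) free_algebra \<Rightarrow> 'v add_end"
  where "rep Rel act x = Add_End (act (coset_of Rel x))"

context
  fixes Rel :: "('g, 'f) free_algebra set" and act
  assumes module: "presented_module scale Rel act"
begin

interpretation M: presented_module scale Rel act by (rule module)

lemma app_rep [simp]: "app (rep Rel act x) v = act (coset_of Rel x) v"
proof -
  have "Vector_Spaces.linear scale scale (act (coset_of Rel x))" by (rule M.act_linear) simp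
  then show ?thesis by (simp add: rep_def app_Add_End Vector_Spaces.linear_iff)
qed

lemma lin_rep [simp]: "lin (rep Rel act x)"
  unfolding linear_app using M.act_linear[of "coset_of Rel x"] by (simp add: app_rep[abs_def])

lemma rep_add: "rep Rel act (x + y) = rep Rel act x + rep Rel act y"
  by (rule add_end_eqI) (simp add: M.act_add flip: coset_of_add)

lemma rep_minus: "rep Rel act (x - y) = rep Rel act x - rep Rel act y"
  using rep_add[of "x - y" y] by (simp add: eq_diff_eq)

lemma rep_zero: "rep Rel act 0 = 0"
  using rep_add[of 0 0] by simp

lemma rep_mult: "rep Rel act (x * y) = rep Rel act x * rep Rel act y"
  by (rule add_end_eqI) (simp add: M.act_mult flip: coset_of_mult)

lemma rep_one: "rep Rel act 1 = 1"
  by (rule add_end_eqI) (simp add: M.act_one flip: one_presented)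

lemma rep_fconst: "rep Rel act (fconst c) = sc c"
proof (rule add_end_eqI)
  fix v
  have "act (coset_of Rel (fconst c * 1)) v = scale c (act (coset_of Rel 1) v)"
    using M.act_scale[of "coset_of Rel 1" c v] by (simp add: coset_of_mult)
  then show "app (rep Rel act (fconst c)) v = app (sc c) v"
    using M.act_one by (simp add: one_presented)
qed

lemma rep_power: "rep Rel act (x ^ n) = rep Rel act x ^ n"
  by (induction n) (simp_all add: rep_mult rep_one)

lemma rep_rel: "x \<in> Rel \<Longrightarrow> rep Rel act x = 0"
  using rep_zero by (simp add: rep_def coset_of_rel)

lemma rep_invariant:
  assumes "subspace W" "\<And>g v. v \<in> W \<Longrightarrow> act (pgen Rel g) v \<in> W" "a \<in> carrier (presented Rel)"
  shows "act a ` W \<subseteq> W"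
proof -
  have "\<forall>v\<in>W. app (rep Rel act x) v \<in> W" for x
    by (induction x rule: free_algebra_induct)
       (use assms(1,2) in \<open>auto simp: rep_fconst rep_add rep_mult subspace_scale subspace_add simp del: app_rep simp flip: app_rep\<close>)
  then show ?thesis using assms(3) by (auto simp: carrier_presented)
qed

end

lemma presented_module_eqI:
  assumes M: "presented_module scale Rel act" and N: "presented_module scale Rel act'"
    and gens: "\<And>g v. act (pgen Rel g) v = act' (pgen Rel g) v"
  shows "act = act'"
proof
  fix a
  have "rep Rel act x = rep Rel act' x" for x
  proof (induction x rule: free_algebra_induct)
    case (gen g)
    show ?case by (rule add_end_eqI) (simp add: app_rep[OF M] app_rep[OF N] gens)
  qed (simp_all add: rep_fconst rep_add rep_mult M N)
  then have *: "act (coset_of Rel x) = act' (coset_of Rel x)" for x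
    using app_rep[OF M, of x] app_rep[OF N, of x] by auto
  show "act a = act' a"
  proof (cases "a \<in> carrier (presented Rel)")
    case True
    then show ?thesis using * by (auto simp: carrier_presented)
  next
    case False
    then show ?thesis
      using presented_module.act_extensional[OF M] presented_module.act_extensional[OF N]
      by (simp add: extensional_def)
  qed
qed

end

section \<open>Identities for q-Serre expressions\<close>

text \<open>
  The q-Serre expression with an arbitrary ring element \<open>c\<close> in place of \<open>[3]\<close>. Below \<open>c = t + 1 + t'\<close>, where
  \<open>t\<close> and \<open>t'\<close> stand for multiplication by \<open>q\<^sup>2\<close> and \<open>q\<^sup>-\<^sup>2\<close>. The identities hold because the rewrite rules
  given by the assumptions bring every monomial into a normal form with \<open>t\<close> and \<open>t'\<close> in front.
\<close>

definition serre :: "'a::{ring,monoid_mult} \<Rightarrow> 'a \<Rightarrow> 'a \<Rightarrow> 'a"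
  where "serre c x y = x ^ 3 * y - c * x ^ 2 * y * x + c * x * y * x ^ 2 - y * x ^ 3"

lemma mult_left_eq: "x * y = z \<Longrightarrow> x * (y * w) = z * (w :: 'a::semigroup_mult)"
  by (simp add: mult.assoc[symmetric])

lemma mult_inverse_eq_iff:
  fixes a b z w :: "'a::monoid_mult"
  assumes "a * b = 1" "b * a = 1"
  shows "z * b = w \<longleftrightarrow> z = w * a"
  using assms by (auto simp: mult.assoc)

text \<open>
  All terms of \<open>serre (t + 1 + t') (k + x) y\<close> that involve \<open>k\<close> cancel.
\<close>

lemma serre_add_weight:
  fixes k x y t t' :: "'a::{ring,monoid_mult}"
  assumes t: "t * t' = 1" "t' * t = 1"
    and comm: "x * t = t * x" "y * t = t * y" "k * t = t * k"
      "x * t' = t' * x" "y * t' = t' * y" "k * t' = t' * k"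
    and wt: "k * x = t * (x * k)" "k * y = t' * (y * k)"
  shows "serre (t + 1 + t') (k + x) y = serre (t + 1 + t') x y"
  by (simp add: serre_def power3_eq_cube power2_eq_square distrib_left distrib_right mult.assoc
    t comm wt t[THEN mult_left_eq] comm[THEN mult_left_eq] wt[THEN mult_left_eq])

text \<open>
  In a representation of the quantum affine algebra, \<open>e\<^sub>i\<^sup>+\<close> commutes with the q-Serre expressions in
  \<open>e\<^sub>0\<^sup>-\<close> and \<open>e\<^sub>1\<^sup>-\<close>. The first lemma is the case where \<open>x\<close> has a nontrivial commutator with the cubed
  variable \<open>r\<close>, the second one that of a nontrivial commutator with \<open>l\<close>.
\<close>

lemma serre_commute_partner_fst:
  fixes r l x k k' h t t' :: "'a::{ring,monoid_mult}"
  assumes t: "t * t' = 1" "t' * t = 1"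
    and comm: "r * t = t * r" "l * t = t * l" "k * t = t * k" "k' * t = t * k'" "x * t = t * x"
      "r * t' = t' * r" "l * t' = t' * l" "k * t' = t' * k" "k' * t' = t' * k'" "x * t' = t' * x"
      "r * h = h * r" "l * h = h * l" "k * h = h * k" "k' * h = h * k'" "t * h = h * t" "t' * h = h * t'"
    and wt: "k * r = t' * (r * k)" "k * l = t * (l * k)" "k' * r = t * (r * k')" "k' * l = t' * (l * k')"
    and rel: "x * r = r * x + h * (k - k')" "x * l = l * x"
  shows "x * serre (t + 1 + t') r l = serre (t + 1 + t') r l * x"
  by (simp add: serre_def power3_eq_cube power2_eq_square distrib_left distrib_right 
    left_diff_distrib right_diff_distrib mult.assoc
    t comm wt rel t[THEN mult_left_eq] comm[THEN mult_left_eq] wt[THEN mult_left_eq] rel[THEN mult_left_eq])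

lemma serre_commute_partner_snd:
  fixes r l y k k' h t t' :: "'a::{ring,monoid_mult}"
  assumes t: "t * t' = 1" "t' * t = 1"
    and comm: "r * t = t * r" "l * t = t * l" "k * t = t * k" "k' * t = t * k'" "y * t = t * y"
      "r * t' = t' * r" "l * t' = t' * l" "k * t' = t' * k" "k' * t' = t' * k'" "y * t' = t' * y"
      "r * h = h * r" "l * h = h * l" "k * h = h * k" "k' * h = h * k'" "t * h = h * t" "t' * h = h * t'"
    and wt: "k * r = t' * (r * k)" "k * l = t * (l * k)" "k' * r = t * (r * k')" "k' * l = t' * (l * k')"
    and rel: "y * l = l * y + h * (k' - k)" "y * r = r * y"
  shows "y * serre (t + 1 + t') r l = serre (t + 1 + t') r l * y"
  by (simp add: serre_def power3_eq_cube power2_eq_square distrib_left distrib_right 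
    left_diff_distrib right_diff_distrib mult.assoc
    t comm wt rel t[THEN mult_left_eq] comm[THEN mult_left_eq] wt[THEN mult_left_eq] rel[THEN mult_left_eq])

lemma serre_weight:
  fixes r l k t t' :: "'a::{ring,monoid_mult}"
  assumes t: "t * t' = 1" "t' * t = 1"
    and comm: "r * t = t * r" "l * t = t * l" "k * t = t * k"
      "r * t' = t' * r" "l * t' = t' * l" "k * t' = t' * k"
    and wt: "k * r = t' * (r * k)" "k * l = t * (l * k)"
  shows "k * serre (t + 1 + t') r l = t' * t' * (serre (t + 1 + t') r l * k)"
  by (simp add: serre_def power3_eq_cube power2_eq_square distrib_left distrib_right 
    left_diff_distrib right_diff_distrib mult.assoc
    t comm wt t[THEN mult_left_eq] comm[THEN mult_left_eq] wt[THEN mult_left_eq])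

section \<open>Weight spaces\<close>

context operators
begin

lemma subspace_app_image: "lin f \<Longrightarrow> subspace W \<Longrightarrow> subspace (app f ` W)"
  unfolding linear_app module_hom_iff_linear[symmetric] by (rule module_hom.subspace_image)

text \<open>
  On the direct sum of finitely many subspaces \<open>W i\<close> there is a linear operator that acts on each \<open>W i\<close> as
  the scalar \<open>c i\<close>.
\<close>

lemma exists_diagonal_operator:
  assumes "finite I" and sub: "\<And>i. i \<in> I \<Longrightarrow> subspace (W i)"
    and span: "span (\<Union>i\<in>I. W i) = UNIV"
    and indep: "\<And>w. (\<And>i. i \<in> I \<Longrightarrow> w i \<in> W i) \<Longrightarrow> (\<Sum>i\<in>I. w i) = 0 \<Longrightarrow> \<forall>i\<in>I. w i = 0"
  obtains B where "lin B" and "\<And>i v. i \<in> I \<Longrightarrow> v \<in> W i \<Longrightarrow> app B v = scale (c i) v"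
proof -
  define dec where "dec v w \<longleftrightarrow> (\<forall>i\<in>I. w i \<in> W i) \<and> v = (\<Sum>i\<in>I. w i)" for v w
  have dec_add: "dec (v + v') (\<lambda>i. w i + w' i)" if "dec v w" "dec v' w'" for v v' w w'
    using that sub by (auto simp: dec_def sum.distrib subspace_add)
  have dec_scale: "dec (scale a v) (\<lambda>i. scale a (w i))" if "dec v w" for a v w
    using that sub by (auto simp: dec_def scale_sum_right subspace_scale)
  have dec_unique: "w i = w' i" if "dec v w" "dec v w'" "i \<in> I" for v w w' i
  proof -
    have "\<forall>i\<in>I. w i - w' i = 0"
      using that sub by (intro indep) (auto simp: dec_def sum_subtractf subspace_diff)
    then show ?thesis using that by simp
  qed
  have dec_W: "dec v (\<lambda>j. if j = i then v else 0)" if "i \<in> I" "v \<in> W i" for i v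
    using that sub \<open>finite I\<close> by (auto simp: dec_def subspace_0)
  have dec_0: "dec 0 (\<lambda>i. 0)"
    using sub by (auto simp: dec_def subspace_0)
  have "\<exists>w. dec v w" for v
  proof -
    have "subspace {v. \<exists>w. dec v w}"
      using dec_add dec_scale dec_0 unfolding subspace_def by blast
    moreover have "(\<Union>i\<in>I. W i) \<subseteq> {v. \<exists>w. dec v w}"
      using dec_W by blast
    ultimately have "span (\<Union>i\<in>I. W i) \<subseteq> {v. \<exists>w. dec v w}"
      by (rule span_minimal[rotated])
    then show ?thesis using span by blast
  qed
  then obtain w where w: "dec v (w v)" for v by metis
  define b where "b v = (\<Sum>i\<in>I. scale (c i) (w v i))" for v
  have b_eq: "b v = (\<Sum>i\<in>I. scale (c i) (u i))" if "dec v u" for v u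
    unfolding b_def using dec_unique[OF w that] by (intro sum.cong) auto
  have b_add: "b (v + v') = b v + b v'" for v v'
    using b_eq[OF dec_add[OF w w]] by (simp add: b_def scale_right_distrib sum.distrib)
  have b_scale: "b (scale a v) = scale a (b v)" for a v
    using b_eq[OF dec_scale[OF w]] by (simp add: b_def scale_sum_right mult.commute)
  show thesis
  proof
    show "lin (Add_End b)"
      by (simp add: lin_iff app_Add_End b_add b_scale)
    show "app (Add_End b) v = scale (c i) v" if "i \<in> I" "v \<in> W i" for i v
      using b_eq[OF dec_W[OF that]] that \<open>finite I\<close>
      by (simp add: app_Add_End b_add if_distrib cong: if_cong)
  qed
qed

text \<open>The eigenspace for \<open>c\<close>, or the zero space if \<open>c\<close> is not an eigenvalue.\<close>

definition eig :: "'v add_end \<Rightarrow> 'f \<Rightarrow> 'v set"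
  where "eig f c = {v. app f v = scale c v}"

end

text \<open>
  The operators on an irreducible module over the Borel subalgebra, apart from the q-Serre relations:
  \<open>k\<close> and its inverse \<open>ki\<close> are the Cartan part, normalized so that the module has type \<open>1\<close>; \<open>x\<close> is the
  raising and \<open>y\<close> the lowering operator.
\<close>

locale weight_module = operators scale + finite_dimensional_vector_space scale Basis
  for scale :: "'f::field \<Rightarrow> 'v::ab_group_add \<Rightarrow> 'v" and Basis +
  fixes q :: 'f and d :: nat and k ki x y :: "'v add_end"
  assumes q0: "q \<noteq> 0" and q_root: "\<And>n::nat. n > 0 \<Longrightarrow> q ^ n \<noteq> 1"
    and lin_gens: "lin k" "lin ki" "lin x" "lin y"
    and k_ki: "k * ki = 1" "ki * k = 1"
    and k_x: "k * x = sc (q\<^sup>2) * (x * k)"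
    and k_y: "k * y = sc (inverse (q\<^sup>2)) * (y * k)"
    and spectrum: "{c. \<exists>v. v \<noteq> 0 \<and> app k v = scale c v} = {q powi (2 * int i - int d) | i. i \<le> d}"
    and irreducible: "\<And>W. subspace W \<Longrightarrow> (\<And>f v. f \<in> {k, ki, x, y} \<Longrightarrow> v \<in> W \<Longrightarrow> app f v \<in> W) \<Longrightarrow>
      W = {0} \<or> W = UNIV"
begin

text \<open>
  The eigenvalues of \<open>k\<close> are the \<open>th i\<close> with \<open>0 \<le> i \<le> d\<close>. Indices range over all integers, so that shifts
  of the index need no side conditions; eigenspaces with an index out of range are zero.
\<close>

definition th :: "int \<Rightarrow> 'f"
  where "th i = q powi (2 * i - int d)"

lemma q_powi_eq_1_iff: "q powi n = 1 \<longleftrightarrow> n = 0"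
proof
  assume *: "q powi n = 1"
  have "q ^ nat \<bar>n\<bar> = 1"
    using * q0 by (cases "n \<ge> 0") (auto simp: power_int_def power_inverse)
  then show "n = 0" using q_root[of "nat \<bar>n\<bar>"] by auto
qed simp

lemma th_nonzero [simp]: "th i \<noteq> 0"
  using q0 by (simp add: th_def)

lemma th_eq_iff [simp]: "th i = th j \<longleftrightarrow> i = j"
proof
  assume "th i = th j"
  then have "q powi ((2 * i - int d) - (2 * j - int d)) = 1"
    using q0 power_int_diff[of q "2 * i - int d" "2 * j - int d"] by (simp add: th_def)
  then show "i = j" by (simp add: q_powi_eq_1_iff)
qed simp

lemma th_add: "th (i + n) = q powi (2 * n) * th i"
proof -
  have "2 * (i + n) - int d = 2 * n + (2 * i - int d)" by simp
  then show ?thesis using power_int_add[of q "2 * n" "2 * i - int d"] q0 by (simp only: th_def) simp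
qed

lemma th_Suc: "th (i + 1) = q\<^sup>2 * th i" "th (1 + i) = q\<^sup>2 * th i"
  using th_add[of i 1] by (simp_all add: add.commute)

lemma th_pred: "th (i - 1) = inverse (q\<^sup>2) * th i"
  using th_Suc(1)[of "i - 1"] q0 by simp

lemma th_reflect: "th (int d - i) = inverse (th i)"
proof -
  have "2 * (int d - i) - int d = - (2 * i - int d)" by simp
  then show ?thesis by (simp only: th_def power_int_minus)
qed

lemma app_k_ki [simp]: "app k (app ki v) = v" "app ki (app k v) = v"
  using arg_cong[OF k_ki(1), of "\<lambda>f. app f v"] arg_cong[OF k_ki(2), of "\<lambda>f. app f v"] by simp_all

lemma app_k_x: "app k (app x v) = scale (q\<^sup>2) (app x (app k v))"
  using arg_cong[OF k_x, of "\<lambda>f. app f v"] by simp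

lemma app_k_y: "app k (app y v) = scale (inverse (q\<^sup>2)) (app y (app k v))"
  using arg_cong[OF k_y, of "\<lambda>f. app f v"] by simp

lemma eig_k_outside: "v \<in> eig k (th j) \<Longrightarrow> j \<notin> {0..int d} \<Longrightarrow> v = 0"
proof (rule ccontr)
  assume "v \<in> eig k (th j)" "j \<notin> {0..int d}" "v \<noteq> 0"
  then have "th j \<in> {q powi (2 * int i - int d) | i. i \<le> d}"
    using spectrum by (auto simp: eig_def)
  then obtain i :: nat where "i \<le> d" "th j = th (int i)"
    by (auto simp: th_def)
  then show False using \<open>j \<notin> {0..int d}\<close> by auto
qed

lemma eig_k_nonzero: "j \<in> {0..int d} \<Longrightarrow> \<exists>v. v \<noteq> 0 \<and> v \<in> eig k (th j)"
proof -
  assume j: "j \<in> {0..int d}"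
  then have "th j = q powi (2 * int (nat j) - int d)" "nat j \<le> d"
    by (auto simp: th_def)
  then have "th j \<in> {c. \<exists>v. v \<noteq> 0 \<and> app k v = scale c v}"
    unfolding spectrum by blast
  then show ?thesis by (auto simp: eig_def)
qed

lemma eig_k_x: "v \<in> eig k (th j) \<Longrightarrow> app x v \<in> eig k (th (j + 1))"
  by (simp add: eig_def app_k_x lin_scale lin_gens th_Suc)

lemma eig_k_y: "v \<in> eig k (th j) \<Longrightarrow> app y v \<in> eig k (th (j - 1))"
  by (simp add: eig_def app_k_y lin_scale lin_gens th_pred)

lemma eig_k_ki: "v \<in> eig k (th j) \<Longrightarrow> app ki v = scale (inverse (th j)) v"
proof -
  assume "v \<in> eig k (th j)"
  then have "app k v = scale (th j) v" by (simp add: eig_def)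
  then have "app ki (scale (th j) v) = v" using app_k_ki(2)[of v] by simp
  then have "scale (th j) (app ki v) = v" by (simp add: lin_scale lin_gens)
  then have "scale (inverse (th j)) (scale (th j) (app ki v)) = scale (inverse (th j)) v" by simp
  then show ?thesis by simp
qed

text \<open>
  The kernel of \<open>z\<close> is invariant, and it contains the eigenspace of lowest or highest index, according to
  the sign of \<open>n\<close>, since the eigenspace into which \<open>z\<close> maps it is zero.
\<close>

lemma commuting_weight_shift_zero:
  assumes "lin z" "x * z = z * x" "y * z = z * y" "n \<noteq> 0" "k * z = sc (q powi (2 * n)) * (z * k)"
  shows "z = 0"
proof -
  let ?W = "{v. app z v = 0}"
  have comm: "app z (app x v) = app x (app z v)" "app z (app y v) = app y (app z v)" for v
    using arg_cong[OF assms(2), of "\<lambda>f. app f v"] arg_cong[OF assms(3), of "\<lambda>f. app f v"] by simp_all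
  have kz: "app k (app z v) = scale (q powi (2 * n)) (app z (app k v))" for v
    using arg_cong[OF assms(5), of "\<lambda>f. app f v"] by simp
  have kz': "app z (app k v) = scale (inverse (q powi (2 * n))) (app k (app z v))" for v
    using kz[of v] q0 by simp
  have z_ki: "app z (app ki v) = scale (q powi (2 * n)) (app ki (app z v))" for v
  proof -
    have "app ki (app k (app z (app ki v))) = app ki (scale (q powi (2 * n)) (app z v))"
      using kz[of "app ki v"] by simp
    then show ?thesis by (simp add: lin_scale lin_gens)
  qed
  have "?W = {0} \<or> ?W = UNIV"
    by (rule irreducible) (auto simp: subspace_kernel assms(1) comm kz' z_ki)
  moreover have "?W \<noteq> {0}"
  proof -
    define j where "j = (if n < 0 then 0 else int d)"
    obtain v where v: "v \<noteq> 0" "v \<in> eig k (th j)"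
      using eig_k_nonzero[of j] by (cases "n < 0") (auto simp: j_def)
    have "app z v \<in> eig k (th (j + n))"
      using v by (simp add: eig_def kz lin_scale assms(1) th_add)
    then have "app z v = 0"
      using \<open>n \<noteq> 0\<close> by (intro eig_k_outside) (auto simp: j_def split: if_splits)
    then show ?thesis using v by blast
  qed
  ultimately show ?thesis by (auto intro!: add_end_eqI)
qed

text \<open>The sum of the eigenspaces of \<open>f\<close> for the scalars \<open>th j\<close> with \<open>j \<in> S\<close>.\<close>

definition eig_span :: "'v add_end \<Rightarrow> int set \<Rightarrow> 'v set"
  where "eig_span f S = span (\<Union>j\<in>S. eig f (th j))"

lemma subspace_eig_span [simp]: "subspace (eig_span f S)"
  by (simp add: eig_span_def)

lemma eig_span_mono: "S \<subseteq> T \<Longrightarrow> v \<in> eig_span f S \<Longrightarrow> v \<in> eig_span f T"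
  unfolding eig_span_def using span_mono[of "\<Union>j\<in>S. eig f (th j)" "\<Union>j\<in>T. eig f (th j)"] by blast

lemma eig_in_eig_span: "v \<in> eig f (th j) \<Longrightarrow> j \<in> S \<Longrightarrow> v \<in> eig_span f S"
  unfolding eig_span_def by (intro span_base) blast

lemma eig_span_minimal:
  "v \<in> eig_span f S \<Longrightarrow> subspace W \<Longrightarrow> (\<And>j v. j \<in> S \<Longrightarrow> v \<in> eig f (th j) \<Longrightarrow> v \<in> W) \<Longrightarrow> v \<in> W"
  unfolding eig_span_def using span_minimal[of "\<Union>j\<in>S. eig f (th j)" W] by blast

lemma app_eig_span:
  assumes "lin g" "v \<in> eig_span f S" "subspace W"
    and "\<And>j v. j \<in> S \<Longrightarrow> v \<in> eig f (th j) \<Longrightarrow> app g v \<in> W"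
  shows "app g v \<in> W"
  using eig_span_minimal[OF assms(2) subspace_app_vimage[OF assms(1,3)]] assms(4) by blast

text \<open>
  The operator \<open>f - th i\<close> maps \<open>eig_span f S\<close> onto itself when \<open>i \<notin> S\<close>. Hence \<open>w\<close> differs from an element
  of \<open>eig_span f S\<close> by an element of the kernel of \<open>f - th i\<close>.
\<close>

lemma eig_span_insertI:
  assumes "lin f" "app f w - scale (th i) w \<in> eig_span f S" "i \<notin> S"
  shows "w \<in> eig_span f (insert i S)"
proof -
  let ?g = "f - sc (th i)"
  have "app f w - scale (th i) w \<in> app ?g ` eig_span f S"
  proof (rule eig_span_minimal[OF assms(2)])
    show "subspace (app ?g ` eig_span f S)"
      by (intro subspace_app_image lin_simps assms subspace_eig_span)
    fix j v assume j: "j \<in> S" "v \<in> eig f (th j)"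
    have "th j - th i \<noteq> 0" using j assms(3) by auto
    moreover have "app ?g (scale a v) = scale (a * (th j - th i)) v" for a
      using j(2) by (simp add: eig_def lin_scale[OF assms(1)] right_diff_distrib scale_left_diff_distrib mult.commute)
    ultimately have "v = app ?g (scale (inverse (th j - th i)) v)"
      by simp
    moreover have "scale (inverse (th j - th i)) v \<in> eig_span f S"
      using j by (intro subspace_scale subspace_eig_span eig_in_eig_span)
    ultimately show "v \<in> app ?g ` eig_span f S" by blast
  qed
  then obtain w' where w': "w' \<in> eig_span f S" "app f w - scale (th i) w = app f w' - scale (th i) w'"
    by auto
  then have "w - w' \<in> eig f (th i)"
    by (simp add: eig_def app_diff scale_right_diff_distrib algebra_simps)
  then have "(w - w') + w' \<in> eig_span f (insert i S)"
    using w' by (intro subspace_add subspace_eig_span)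
      (auto intro: eig_in_eig_span eig_span_mono[of S])
  then show ?thesis by simp
qed

text \<open>
  On the eigenspace of highest index \<open>i\<close>, the operator \<open>g - c i\<close> vanishes.
\<close>

lemma eig_span_shift_down:
  assumes "lin g" "v \<in> eig_span f {..i}" and "\<And>j v. v \<in> eig f (th j) \<Longrightarrow> app g v = scale (c j) v"
  shows "app g v - scale (c i) v \<in> eig_span f {..i - 1}"
proof -
  have "app (g - sc (c i)) v \<in> eig_span f {..i - 1}"
  proof (rule app_eig_span[OF _ assms(2) subspace_eig_span])
    fix j v assume j: "j \<in> {..i}" "v \<in> eig f (th j)"
    have "v \<in> eig_span f {..i - 1}" if "j \<noteq> i"
      using j that by (intro eig_in_eig_span) auto
    then show "app (g - sc (c i)) v \<in> eig_span f {..i - 1}"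
      using assms(3)[OF j(2)] by (cases "j = i") (auto simp: subspace_0 subspace_diff subspace_scale)
  qed (use assms in auto)
  then show ?thesis by simp
qed

lemma eig_span_k_UNIV: "eig_span k UNIV = UNIV"
proof -
  have inv: "app f v \<in> eig_span k UNIV" if "f \<in> {k, ki, x, y}" "v \<in> eig_span k UNIV" for f v
  proof (rule app_eig_span[OF _ that(2)])
    fix j v assume v: "v \<in> eig k (th j)"
    then have "v \<in> eig_span k UNIV" by (rule eig_in_eig_span) simp
    moreover have "app x v \<in> eig_span k UNIV" "app y v \<in> eig_span k UNIV"
      using eig_k_x[OF v] eig_k_y[OF v] by (auto intro: eig_in_eig_span)
    ultimately show "app f v \<in> eig_span k UNIV"
      using that(1) eig_k_ki[OF v] v by (auto simp: eig_def subspace_scale)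
  qed (use that lin_gens in auto)
  obtain v where "v \<noteq> 0" "v \<in> eig k (th 0)"
    using eig_k_nonzero[of 0] by auto
  then have "eig_span k UNIV \<noteq> {0}"
    using eig_in_eig_span[of v k 0 UNIV] by auto
  then show ?thesis using irreducible[OF subspace_eig_span inv] by blast
qed

lemma eig_span_k_trivial:
  assumes "S \<inter> {0..int d} = {}" "v \<in> eig_span k S"
  shows "v = 0"
proof -
  have "v \<in> {0}"
  proof (rule eig_span_minimal[OF assms(2)])
    show "w \<in> {0}" if "j \<in> S" "w \<in> eig k (th j)" for j w
      using eig_k_outside[OF that(2)] that(1) assms(1) by blast
  qed simp
  then show ?thesis by simp
qed

end

section \<open>Two filtrations and their splitting\<close>

context finite_dimensional_vector_space
begin

lemma invariant_inverse:
  assumes f: "Vector_Spaces.linear scale scale f" and g: "\<And>v. g (f v) = v" "\<And>v. f (g v) = v"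
    and W: "subspace W" "\<And>v. v \<in> W \<Longrightarrow> f v \<in> W" and v: "v \<in> W"
  shows "g v \<in> W"
proof -
  interpret finite_dimensional_vector_space_pair scale Basis scale Basis
    by unfold_locales
  have "inj f" by (metis g(1) injI)
  then have "dim (f ` W) = dim W"
    by (intro dim_image_eq[OF f]) (auto intro: inj_on_subset)
  moreover have "subspace (f ` W)" 
    using f W(1) unfolding module_hom_iff_linear[symmetric] by (rule module_hom.subspace_image)
  ultimately have "f ` W = W"
    using W by (intro subspace_dim_equal) auto
  then show ?thesis using v g(1) by (metis imageE)
qed

end

text \<open>
  One q-Serre relation suffices for the partner of \<open>x\<close>, the operator \<open>r\<close> constructed below; the other
  relation is used for the partner of \<open>y\<close> by symmetry.
\<close>

locale serre_module = weight_module scale Basis q d k ki x y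
  for scale :: "'f::field \<Rightarrow> 'v::ab_group_add \<Rightarrow> 'v" and Basis q d k ki x y +
  assumes serre_x_y: "serre (sc (q\<^sup>2) + 1 + sc (inverse (q\<^sup>2))) x y = 0"
begin

definition A :: "'v add_end"
  where "A = k + x"

lemma lin_A [simp]: "lin A"
  by (simp add: A_def lin_gens)

lemma app_A: "app A v = app k v + app x v"
  by (simp add: A_def)

lemma sc_comm: "f \<in> {k, ki, x, y} \<Longrightarrow> f * sc c = sc c * f"
  using lin_gens by (auto simp: lin_def)

lemma sc_inverse: "c \<noteq> 0 \<Longrightarrow> sc c * sc (inverse c) = 1" "c \<noteq> 0 \<Longrightarrow> sc (inverse c) * sc c = 1"
  by (simp_all add: sc_simps(2) flip: sc_simps(6))

lemma serre_A_y: "serre (sc (q\<^sup>2) + 1 + sc (inverse (q\<^sup>2))) A y = 0"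
proof -
  have "serre (sc (q\<^sup>2) + 1 + sc (inverse (q\<^sup>2))) A y = serre (sc (q\<^sup>2) + 1 + sc (inverse (q\<^sup>2))) x y"
    unfolding A_def
    by (rule serre_add_weight) (use q0 in \<open>simp_all add: sc_comm k_x k_y sc_inverse\<close>)
  then show ?thesis by (simp add: serre_x_y)
qed

text \<open>
  With respect to the eigenspaces of \<open>k\<close>, \<open>A\<close> is triangular with distinct diagonal entries. The next
  lemmas conclude that \<open>A\<close> has no eigenvalues \<open>th j\<close> out of range and that it is diagonalizable.
\<close>

lemma A_above:
  assumes "v \<in> eig_span k {i..}"
  shows "app A v - scale (th i) v \<in> eig_span k {i + 1..}"
proof -
  have "app (A - sc (th i)) v \<in> eig_span k {i + 1..}"
  proof (rule app_eig_span[OF _ assms subspace_eig_span])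
    fix j v assume j: "j \<in> {i..}" "v \<in> eig k (th j)"
    have "app x v \<in> eig_span k {i + 1..}"
      using j by (intro eig_in_eig_span[OF eig_k_x]) auto
    moreover have "v \<in> eig_span k {i + 1..}" if "j \<noteq> i"
      using j that by (intro eig_in_eig_span[of _ _ j]) auto
    ultimately show "app (A - sc (th i)) v \<in> eig_span k {i + 1..}"
      using j(2) by (cases "j = i")
        (auto simp: app_A eig_def intro!: subspace_diff subspace_add subspace_scale)
  qed simp
  then show ?thesis by simp
qed

text \<open>
  If \<open>th j\<close> is not one of the eigenvalues of \<open>k\<close>, then each step up the filtration by \<open>eig_span k {n..}\<close>
  loses nothing of an eigenvector for \<open>th j\<close>, and the filtration ends in zero.
\<close>

lemma eig_A_outside:
  assumes "v \<in> eig A (th j)" "j \<notin> {0..int d}"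
  shows "v = 0"
proof -
  have "v \<in> eig_span k {int n..}" if "n \<le> d + 1" for n
    using that
  proof (induction n)
    case 0
    have "v \<in> eig_span k UNIV" using eig_span_k_UNIV by simp
    then have "v \<in> eig_span k {0..}"
    proof (rule eig_span_minimal[OF _ subspace_eig_span])
      show "w \<in> eig_span k {0..}" if "w \<in> eig k (th l)" for l w
        using that eig_k_outside[OF that] subspace_0[OF subspace_eig_span]
        by (cases "l \<in> {0..int d}") (auto intro: eig_in_eig_span)
    qed
    then show ?case by simp
  next
    case (Suc n)
    then have "app A v - scale (th (int n)) v \<in> eig_span k {int n + 1..}"
      by (intro A_above) simp
    then have "scale (th j - th (int n)) v \<in> eig_span k {int n + 1..}"
      using assms(1) by (simp add: eig_def scale_left_diff_distrib)
    then have "scale (inverse (th j - th (int n))) (scale (th j - th (int n)) v) \<in> eig_span k {int n + 1..}"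
      by (rule subspace_scale[OF subspace_eig_span])
    moreover have "th j - th (int n) \<noteq> 0" using Suc.prems assms(2) by auto
    ultimately show ?case by (simp add: add.commute)
  qed
  from this[of "d + 1"] have "v \<in> eig_span k {int (d + 1)..}" by simp
  then show ?thesis by (rule eig_span_k_trivial[rotated]) auto
qed

text \<open>
  The claim for the eigenspace of index \<open>i = d + 1 - n\<close> is that it lies in the sum of the eigenspaces
  of \<open>A\<close> of index at least \<open>i\<close>; induction on \<open>n\<close> descends from the zero eigenspace of index \<open>d + 1\<close>.
\<close>

lemma eig_k_in_eig_span_A:
  assumes "v \<in> eig k (th (int d + 1 - int n))"
  shows "v \<in> eig_span A {int d + 1 - int n..}"
  using assms
proof (induction n arbitrary: v)
  case 0
  then have "v = 0" by (intro eig_k_outside) auto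
  then show ?case by (simp add: subspace_0)
next
  case (Suc n)
  define i where "i = int d + 1 - int (Suc n)"
  have i: "int d + 1 - int n = i + 1" by (simp add: i_def)
  have "app x v \<in> eig_span A {i + 1..}"
    using Suc.IH eig_k_x[OF Suc.prems] unfolding i i_def[symmetric] by blast
  then have "app A v - scale (th i) v \<in> eig_span A {i + 1..}"
    using Suc.prems by (simp add: app_A eig_def i_def)
  then have "v \<in> eig_span A (insert i {i + 1..})"
    by (rule eig_span_insertI[rotated]) auto
  then show ?case unfolding i_def[symmetric] by (rule eig_span_mono[rotated]) auto
qed

lemma eig_span_A_UNIV: "v \<in> eig_span A {..int d}"
proof -
  have *: "w \<in> eig_span A {..int d}" if "w \<in> eig_span A S" for w S
  proof (rule eig_span_minimal[OF that subspace_eig_span])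
    show "w \<in> eig_span A {..int d}" if "w \<in> eig A (th l)" for l w
      using that eig_A_outside[OF that] subspace_0[OF subspace_eig_span]
      by (cases "l \<in> {0..int d}") (auto intro: eig_in_eig_span)
  qed
  have "v \<in> eig_span k UNIV" using eig_span_k_UNIV by simp
  then show ?thesis
  proof (rule eig_span_minimal[OF _ subspace_eig_span])
    fix j w assume j: "w \<in> eig k (th j)"
    show "w \<in> eig_span A {..int d}"
    proof (cases "j \<in> {0..int d}")
      case True
      then have "j = int d + 1 - int (nat (int d + 1 - j))" by auto
      then show ?thesis using * eig_k_in_eig_span_A j by metis
    next
      case False
      then show ?thesis using eig_k_outside[OF j] by (simp add: subspace_0)
    qed
  qed
qed

lemma eig_span_A_trivial:
  assumes "i < 0" "v \<in> eig_span A {..i}"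
  shows "v = 0"
proof -
  have "v \<in> {0}"
  proof (rule eig_span_minimal[OF assms(2)])
    show "w \<in> {0}" if "j \<in> {..i}" "w \<in> eig A (th j)" for j w
      using eig_A_outside[OF that(2)] that(1) assms(1) by auto
  qed simp
  then show ?thesis by simp
qed

lemma eig_span_k_proper: "\<exists>v. v \<notin> eig_span k {..int d - 1}"
proof -
  obtain v where v: "v \<noteq> 0" "v \<in> eig k (th (int d))" using eig_k_nonzero[of "int d"] by auto
  have "v \<notin> eig_span k {..int d - 1}"
  proof
    assume v_mem: "v \<in> eig_span k {..int d - 1}"
    have "v \<in> eig_span k {..int d - 1 - int n}" for n
    proof (induction n)
      case 0
      then show ?case using v_mem by simp
    next
      case (Suc n)
      define i where "i = int d - 1 - int n"
      have "app k v - scale (th i) v \<in> eig_span k {..i - 1}"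
        using Suc by (intro eig_span_shift_down) (auto simp: eig_def lin_gens i_def)
      then have "scale (th (int d) - th i) v \<in> eig_span k {..i - 1}"
        using v(2) by (simp add: eig_def scale_left_diff_distrib)
      then have "scale (inverse (th (int d) - th i)) (scale (th (int d) - th i) v) \<in> eig_span k {..i - 1}"
        by (rule subspace_scale[OF subspace_eig_span])
      moreover have "th (int d) - th i \<noteq> 0" by (auto simp: i_def)
      moreover have "i - 1 = int d - 1 - int (Suc n)" by (simp add: i_def)
      ultimately show ?case by simp
    qed
    from this[of d] have "v \<in> eig_span k {..-1}" by simp
    then have "v = 0" by (rule eig_span_k_trivial[rotated]) auto
    then show False using v by simp
  qed
  then show ?thesis by blast
qed

lemma ki_eig_A:
  assumes "v \<in> eig A (th j)"
  shows "app ki v \<in> eig_span A {..j + 1}"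
proof -
  have kx: "app ki (app x v) = scale (inverse (q\<^sup>2)) (app x (app ki v))" for v
  proof -
    have "app ki (app k (app x (app ki v))) = app ki (scale (q\<^sup>2) (app x v))"
      by (simp add: app_k_x)
    then have "app x (app ki v) = scale (q\<^sup>2) (app ki (app x v))"
      by (simp add: lin_scale lin_gens)
    then show ?thesis using q0 by simp
  qed
  have A_ki: "app A (app ki v) = v + scale (q\<^sup>2) (app ki (app A v - app k v))"
    using q0 by (simp add: app_A kx)
  also have "\<dots> = scale (th (j + 1)) (app ki v) + scale (1 - q\<^sup>2) v"
    using assms by (simp add: eig_def app_diff lin_scale lin_gens th_Suc scale_right_diff_distrib
      scale_left_diff_distrib algebra_simps)
  finally have "app A (app ki v) - scale (th (j + 1)) (app ki v) = scale (1 - q\<^sup>2) v" by simp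
  also have "\<dots> \<in> eig_span A {j}"
    using assms by (intro subspace_scale subspace_eig_span eig_in_eig_span) auto
  finally have "app ki v \<in> eig_span A (insert (j + 1) {j})"
    by (rule eig_span_insertI[rotated]) auto
  then show ?thesis by (rule eig_span_mono[rotated]) auto
qed

lemma y_eig_A:
  assumes "v \<in> eig A (th j)"
  shows "app y v \<in> eig_span A {..j + 1}"
proof -
  define a b c where "a = th (j - 1)" and "b = th j" and "c = th (j + 1)"
  have abc: "a = inverse (q\<^sup>2) * b" "c = q\<^sup>2 * b" by (simp_all add: a_def b_def c_def th_pred th_Suc)
  define w where "w = app y v"
  define w1 where "w1 = app A w - scale a w"
  define w2 where "w2 = app A w1 - scale b w1"
  have Av: "app A v = scale b v" using assms by (simp add: eig_def b_def)
  \<comment> \<open>On an eigenvector of \<open>A\<close> the q-Serre relation becomes the factorized cubic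
    \<open>(A - c) (A - b) (A - a) y v = 0\<close>.\<close>
  have "app A w2 - scale c w2 = app (serre (sc (q\<^sup>2) + 1 + sc (inverse (q\<^sup>2))) A y) v"
    using q0
    by (simp add: w2_def w1_def w_def serre_def power3_eq_cube power2_eq_square Av lin_scale lin_gens
      app_add app_diff scale_right_distrib scale_left_distrib scale_right_diff_distrib abc algebra_simps)
  also have "\<dots> = 0" by (simp add: serre_A_y)
  finally have "app A w2 - scale c w2 \<in> eig_span A {}" by (simp add: subspace_0)
  then have "w2 \<in> eig_span A (insert (j + 1) {})"
    unfolding c_def by (rule eig_span_insertI[rotated]) auto
  then have "w1 \<in> eig_span A (insert j (insert (j + 1) {}))"
    unfolding w2_def b_def by (rule eig_span_insertI[OF lin_A]) auto
  then have "w \<in> eig_span A (insert (j - 1) (insert j (insert (j + 1) {})))"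
    unfolding w1_def a_def by (rule eig_span_insertI[OF lin_A]) auto
  then show ?thesis unfolding w_def by (rule eig_span_mono[rotated]) auto
qed

lemma eig_span_shift_up:
  assumes "lin g" "\<And>j v. v \<in> eig f (th j) \<Longrightarrow> app g v \<in> eig_span f {..j + n}" "v \<in> eig_span f {..i}"
  shows "app g v \<in> eig_span f {..i + n}"
  using assms(3) by (rule app_eig_span[OF assms(1) _ subspace_eig_span])
    (auto intro: eig_span_mono[OF _ assms(2)])

text \<open>
  The intersection of the ascending filtrations given by \<open>k\<close> and \<open>A\<close>, in degrees \<open>i\<close> and \<open>m - i\<close>.
\<close>

definition piece :: "int \<Rightarrow> int \<Rightarrow> 'v set"
  where "piece m i = eig_span k {..i} \<inter> eig_span A {..m - i}"

lemma subspace_piece [simp]: "subspace (piece m i)"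
  by (simp add: piece_def subspace_inter)

lemma piece_A:
  assumes "v \<in> piece m i"
  shows "app A v - scale (th (m - i)) v \<in> piece m (i + 1)"
proof -
  have v: "v \<in> eig_span k {..i}" "v \<in> eig_span A {..m - i}" using assms by (auto simp: piece_def)
  have "app A v \<in> eig_span k {..i + 1}"
  proof (rule eig_span_shift_up[OF lin_A _ v(1)])
    show "app A w \<in> eig_span k {..j + 1}" if "w \<in> eig k (th j)" for j w
    proof -
      have "app x w \<in> eig_span k {..j + 1}" by (rule eig_in_eig_span[OF eig_k_x[OF that]]) auto
      moreover have "w \<in> eig_span k {..j + 1}" by (rule eig_in_eig_span[OF that]) auto
      ultimately show ?thesis using that
        by (auto simp: app_A eig_def intro!: subspace_add subspace_scale)
    qed
  qed
  moreover have "v \<in> eig_span k {..i + 1}" using v(1) by (rule eig_span_mono[rotated]) auto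
  moreover have "app A v - scale (th (m - i)) v \<in> eig_span A {..m - i - 1}"
    by (rule eig_span_shift_down[OF lin_A v(2)]) (auto simp: eig_def)
  ultimately show ?thesis
    by (auto simp: piece_def algebra_simps intro!: subspace_diff subspace_scale)
qed

lemma piece_ki:
  assumes "v \<in> piece m i"
  shows "app ki v - scale (inverse (th i)) v \<in> piece m (i - 1)"
proof -
  have v: "v \<in> eig_span k {..i}" "v \<in> eig_span A {..m - i}" using assms by (auto simp: piece_def)
  have "app ki v - scale (inverse (th i)) v \<in> eig_span k {..i - 1}"
    by (rule eig_span_shift_down[OF _ v(1)]) (auto simp: lin_gens eig_k_ki)
  moreover have "app ki v \<in> eig_span A {..m - i + 1}"
    by (rule eig_span_shift_up[OF _ _ v(2)]) (auto simp: lin_gens ki_eig_A)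
  moreover have "v \<in> eig_span A {..m - i + 1}" using v(2) by (rule eig_span_mono[rotated]) auto
  moreover have "m - i + 1 = m - (i - 1)" by simp
  ultimately show ?thesis
    unfolding piece_def by (metis IntI subspace_diff subspace_eig_span subspace_scale)
qed

lemma piece_y:
  assumes "v \<in> piece m i"
  shows "app y v \<in> piece m (i - 1)"
proof -
  have v: "v \<in> eig_span k {..i}" "v \<in> eig_span A {..m - i}" using assms by (auto simp: piece_def)
  have "app y v \<in> eig_span k {..i + (- 1)}"
    by (rule eig_span_shift_up[OF _ _ v(1)]) (auto simp: lin_gens intro: eig_in_eig_span[OF eig_k_y])
  moreover have "app y v \<in> eig_span A {..m - i + 1}"
    by (rule eig_span_shift_up[OF _ _ v(2)]) (auto simp: lin_gens y_eig_A)
  moreover have "m - i + 1 = m - (i - 1)" by simp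
  ultimately show ?thesis
    unfolding piece_def by simp
qed

text \<open>
  Each of \<open>A\<close>, \<open>ki\<close> and \<open>y\<close> raises one of the two degrees of a piece by at most one and lowers the other
  one, up to a scalar; so it preserves the sum of the pieces of a given total degree \<open>m\<close>.
\<close>

definition pieces :: "int \<Rightarrow> 'v set"
  where "pieces m = span (\<Union>i. piece m i)"

lemma piece_in_pieces: "v \<in> piece m i \<Longrightarrow> v \<in> pieces m"
  unfolding pieces_def by (intro span_base) blast

lemma subspace_pieces [simp]: "subspace (pieces m)"
  by (simp add: pieces_def)

lemma app_pieces:
  assumes "lin f" "\<And>i v. v \<in> piece m i \<Longrightarrow> app f v \<in> pieces m" "v \<in> pieces m"
  shows "app f v \<in> pieces m"
  using assms(3) unfolding pieces_def
  by (rule app_span[OF assms(1) _ subspace_span, rotated])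
     (use assms(2) in \<open>auto simp flip: pieces_def\<close>)

lemma pieces_dichotomy: "pieces m = {0} \<or> pieces m = UNIV"
proof -
  have A: "app A v \<in> pieces m" if "v \<in> pieces m" for v
  proof (rule app_pieces[OF lin_A _ that])
    fix i v assume v: "v \<in> piece m i"
    have "(app A v - scale (th (m - i)) v) + scale (th (m - i)) v \<in> pieces m"
      by (intro subspace_add subspace_scale subspace_pieces piece_in_pieces[OF v] piece_in_pieces[OF piece_A[OF v]])
    then show "app A v \<in> pieces m" by simp
  qed
  have ki: "app ki v \<in> pieces m" if "v \<in> pieces m" for v
  proof (rule app_pieces[OF _ _ that])
    fix i v assume v: "v \<in> piece m i"
    have "(app ki v - scale (inverse (th i)) v) + scale (inverse (th i)) v \<in> pieces m"
      by (intro subspace_add subspace_scale subspace_pieces piece_in_pieces[OF v] piece_in_pieces[OF piece_ki[OF v]])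
    then show "app ki v \<in> pieces m" by simp
  qed (simp add: lin_gens)
  have y: "app y v \<in> pieces m" if "v \<in> pieces m" for v
    by (rule app_pieces[OF _ _ that]) (auto simp: lin_gens intro: piece_in_pieces piece_y)
  \<comment> \<open>An injective operator maps an invariant subspace of finite dimension onto itself.\<close>
  have k: "app k v \<in> pieces m" if "v \<in> pieces m" for v
    by (rule invariant_inverse[of "app ki" "app k", OF _ _ _ subspace_pieces ki that])
      (simp_all add: lin_gens flip: linear_app)
  have "app x v \<in> pieces m" if "v \<in> pieces m" for v
    using subspace_diff[OF subspace_pieces A[OF that] k[OF that]] by (simp add: app_A)
  then show ?thesis
    using k ki y by (intro irreducible) auto
qed

lemma piece_trivial:
  assumes "v \<in> piece m i" "i < 0 \<or> m < i"
  shows "v = 0"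
  using assms(2)
proof
  assume "i < 0"
  then show ?thesis using assms(1) by (intro eig_span_k_trivial[of "{..i}"]) (auto simp: piece_def)
next
  assume "m < i"
  then show ?thesis using assms(1) by (intro eig_span_A_trivial[of "m - i"]) (auto simp: piece_def)
qed

lemma pieces_below: "pieces (int d - 1) = {0}"
proof -
  have "v \<in> eig_span k {..int d - 1}" if "v \<in> piece (int d - 1) i" for v i
  proof (cases "i \<le> int d - 1")
    case True
    then show ?thesis using that by (auto simp: piece_def intro: eig_span_mono[of "{..i}"])
  next
    case False
    then show ?thesis using piece_trivial[OF that] by (simp add: subspace_0)
  qed
  then have "pieces (int d - 1) \<subseteq> eig_span k {..int d - 1}"
    unfolding pieces_def by (intro span_minimal) auto
  then show ?thesis using eig_span_k_proper pieces_dichotomy by blast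
qed

lemma pieces_UNIV: "pieces (int d) = UNIV"
proof -
  obtain v where v: "v \<noteq> 0" "v \<in> eig k (th 0)" using eig_k_nonzero[of 0] by auto
  have "v \<in> piece (int d) 0"
    using v eig_span_A_UNIV by (simp add: piece_def eig_in_eig_span)
  then have "v \<in> pieces (int d)" by (rule piece_in_pieces)
  then show ?thesis using v pieces_dichotomy by blast
qed

text \<open>
  The summand of highest index in a linear relation would lie in a piece of total degree \<open>d - 1\<close>.
\<close>

lemma pieces_independent:
  assumes "finite I" "\<And>i. i \<in> I \<Longrightarrow> w i \<in> piece (int d) i" "(\<Sum>i\<in>I. w i) = 0"
  shows "\<forall>i\<in>I. w i = 0"
proof (rule ccontr)
  define J where "J = {i \<in> I. w i \<noteq> 0}"
  assume "\<not> (\<forall>i\<in>I. w i = 0)"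
  then have J: "finite J" "J \<noteq> {}" using assms(1) by (auto simp: J_def)
  define i where "i = Max J"
  have i: "i \<in> J" using J by (simp add: i_def)
  have "sum w J = sum w I"
    by (rule sum.mono_neutral_left) (auto simp: J_def assms(1))
  then have "sum w J = 0" using assms(3) by simp
  then have "w i + (\<Sum>j\<in>J - {i}. w j) = 0"
    using sum.remove[OF J(1) i, of w] by simp
  then have wi: "w i = - (\<Sum>j\<in>J - {i}. w j)" by (simp add: eq_neg_iff_add_eq_0)
  have "w j \<in> eig_span k {..i - 1}" if "j \<in> J - {i}" for j
  proof -
    have "j \<le> i" using that J by (simp add: i_def)
    then have "j \<le> i - 1" using that by auto
    then show ?thesis using that assms(2)[of j]
      by (auto simp: J_def piece_def intro: eig_span_mono[of "{..j}"])
  qed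
  then have "w i \<in> eig_span k {..i - 1}"
    unfolding wi by (intro subspace_neg subspace_sum subspace_eig_span) auto
  moreover have "w i \<in> eig_span A {..int d - 1 - (i - 1)}"
    using i assms(2)[of i] by (auto simp: J_def piece_def)
  ultimately have "w i \<in> piece (int d - 1) (i - 1)" by (simp add: piece_def)
  then have "w i = 0" using piece_in_pieces pieces_below by blast
  then show False using i by (simp add: J_def)
qed

lemma exists_pieces_diagonal:
  obtains B where "lin B" "\<And>i v. v \<in> piece (int d) i \<Longrightarrow> app B v = scale (th i) v"
proof -
  have outside: "v = 0" if "v \<in> piece (int d) i" "i \<notin> {0..int d}" for i v
    using piece_trivial[OF that(1)] that(2) by auto
  have "(\<Union>i. piece (int d) i) \<subseteq> span (\<Union>i\<in>{0..int d}. piece (int d) i)"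
  proof
    fix v assume "v \<in> (\<Union>i. piece (int d) i)"
    then obtain i where i: "v \<in> piece (int d) i" by blast
    show "v \<in> span (\<Union>i\<in>{0..int d}. piece (int d) i)"
      using i outside[OF i] by (cases "i \<in> {0..int d}") (auto simp: span_zero intro!: span_base)
  qed
  then have "pieces (int d) \<subseteq> span (\<Union>i\<in>{0..int d}. piece (int d) i)"
    unfolding pieces_def by (intro span_minimal) auto
  then have span: "span (\<Union>i\<in>{0..int d}. piece (int d) i) = UNIV"
    using pieces_UNIV by blast
  obtain B where B: "lin B" "\<And>i v. i \<in> {0..int d} \<Longrightarrow> v \<in> piece (int d) i \<Longrightarrow> app B v = scale (th i) v"
    by (rule exists_diagonal_operator[of "{0..int d}" "piece (int d)" th])
       (use span pieces_independent[of "{0..int d}"] in auto)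
  show thesis
  proof
    show "app B v = scale (th i) v" if "v \<in> piece (int d) i" for i v
      using B(2)[OF _ that] outside[OF that] by (cases "i \<in> {0..int d}") auto
  qed (fact B(1))
qed

lemma eq_on_pieces:
  assumes "lin f" "lin g" "\<And>i v. v \<in> piece (int d) i \<Longrightarrow> app f v = app g v"
  shows "f = g"
proof (rule add_end_eqI)
  fix v
  have "v \<in> span (\<Union>i. piece (int d) i)" using pieces_UNIV by (simp add: pieces_def)
  then show "app f v = app g v"
    by (rule app_eq_on_span[OF assms(1,2), rotated]) (use assms(3) in auto)
qed

text \<open>
  With \<open>B\<close> as above, \<open>s = B - k\<close> lowers the index of the eigenspaces of \<open>k\<close>: the relation between \<open>B\<close> and
  \<open>ki\<close> turns into the first relation below, that between \<open>B\<close> and \<open>A\<close> into the second one.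
\<close>

lemma exists_lowering_part:
  obtains s where "lin s" "s * ki = sc (inverse (q\<^sup>2)) * (ki * s)"
    "s * x - sc (q\<^sup>2) * (x * s) = sc (1 - q\<^sup>2) * (1 - k * k)"
    "s * y = sc (inverse (q\<^sup>2)) * (y * s)"
proof -
  obtain B where B: "lin B" "\<And>i v. v \<in> piece (int d) i \<Longrightarrow> app B v = scale (th i) v"
    using exists_pieces_diagonal by blast
  have B_ki: "B * ki = sc (inverse (q\<^sup>2)) * (ki * B) + sc (1 - inverse (q\<^sup>2))"
  proof (rule eq_on_pieces)
    fix i v assume v: "v \<in> piece (int d) i"
    define w where "w = app ki v - scale (inverse (th i)) v"
    have ki: "app ki v = scale (inverse (th i)) v + w" by (simp add: w_def)
    have "app B w = scale (th (i - 1)) w" using piece_ki[OF v] by (intro B(2)) (simp add: w_def)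
    then show "app (B * ki) v = app (sc (inverse (q\<^sup>2)) * (ki * B) + sc (1 - inverse (q\<^sup>2))) v"
      by (simp add: B(2)[OF v] lin_scale B(1) lin_gens ki app_add th_pred scale_right_distrib scale_left_diff_distrib)
  qed (auto simp: B lin_gens)
  have B_A: "B * A = sc (q\<^sup>2) * (A * B) + sc (1 - q\<^sup>2)"
  proof (rule eq_on_pieces)
    fix i v assume v: "v \<in> piece (int d) i"
    define w where "w = app A v - scale (inverse (th i)) v"
    have A: "app A v = scale (inverse (th i)) v + w" by (simp add: w_def)
    have "app B w = scale (th (i + 1)) w" using piece_A[OF v] by (intro B(2)) (simp add: w_def th_reflect)
    then show "app (B * A) v = app (sc (q\<^sup>2) * (A * B) + sc (1 - q\<^sup>2)) v"
      by (simp add: B(2)[OF v] lin_scale B(1) A app_add th_Suc scale_right_distrib scale_left_diff_distrib)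
  qed (auto simp: B)
  have B_y: "B * y = sc (inverse (q\<^sup>2)) * (y * B)"
  proof (rule eq_on_pieces)
    fix i v assume v: "v \<in> piece (int d) i"
    show "app (B * y) v = app (sc (inverse (q\<^sup>2)) * (y * B)) v"
      by (simp add: B(2)[OF v] B(2)[OF piece_y[OF v]] lin_scale lin_gens th_pred)
  qed (auto simp: B lin_gens)
  define s where "s = B - k"
  have s_ki: "s * ki = sc (inverse (q\<^sup>2)) * (ki * s)"
    by (simp add: s_def left_diff_distrib right_diff_distrib B_ki k_ki sc_simps)
  have "ki * (s * k) = ki * (sc (q\<^sup>2) * (k * s))"
  proof -
    have "sc (q\<^sup>2) * (s * ki) * k = ki * (s * k)"
      unfolding s_ki using q0 by (simp add: mult.assoc[symmetric] flip: sc_simps) (simp add: sc_simps)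
    then have "sc (q\<^sup>2) * s = ki * (s * k)" by (simp add: mult.assoc k_ki)
    moreover have "ki * (sc (q\<^sup>2) * (k * s)) = sc (q\<^sup>2) * s"
      by (simp add: mult.assoc[symmetric] sc_comm) (simp add: mult.assoc[symmetric] k_ki mult.assoc)
    ultimately show ?thesis by simp
  qed
  then have "k * ki * (s * k) = k * ki * (sc (q\<^sup>2) * (k * s))" by (simp only: mult.assoc)
  then have s_k: "s * k = sc (q\<^sup>2) * (k * s)" by (simp add: k_ki)
  have "s * x - sc (q\<^sup>2) * (x * s) = sc (1 - q\<^sup>2) * (1 - k * k)"
  proof -
    have "(k + s) * (k + x) - sc (q\<^sup>2) * ((k + x) * (k + s)) = sc (1 - q\<^sup>2)"
      using B_A by (simp add: s_def A_def)
    then show ?thesis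
      by (simp add: distrib_left distrib_right right_diff_distrib left_diff_distrib k_x s_k sc_simps algebra_simps)
  qed
  moreover have "s * y = sc (inverse (q\<^sup>2)) * (y * s)"
    by (simp add: s_def left_diff_distrib right_diff_distrib B_y k_y)
  ultimately show thesis using that[of s] s_ki B(1) lin_gens by (simp add: s_def)
qed

end

section \<open>The partners of the raising and lowering operators\<close>

context weight_module
begin

declare q0 [simp]

lemma q_minus_inverse_nonzero: "q - inverse q \<noteq> 0"
proof
  assume "q - inverse q = 0"
  then have "q ^ 2 = 1" using q0 by (simp add: power2_eq_square field_simps)
  then show False using q_root[of 2] by simp
qed

lemma ki_weight:
  assumes "k * z = sc c * (z * k)" "c \<noteq> 0"
  shows "ki * z = sc (inverse c) * (z * ki)"
proof -
  have "sc c * (ki * z * k) = ki * (sc c * (z * k))"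
    using sc_simps lin_gens(2) by (simp add: lin_def mult.assoc flip: mult.assoc[of ki "sc c"])
  also have "\<dots> = ki * (k * z)" by (simp add: assms)
  also have "\<dots> = z" by (simp add: k_ki flip: mult.assoc)
  finally have *: "sc c * (ki * z * k) = z" .
  have "sc (inverse c) * (z * ki) = sc (inverse c) * (sc c * (ki * z * k) * ki)" by (simp only: *)
  also have "\<dots> = sc (inverse c) * sc c * (ki * z * (k * ki))" by (simp only: mult.assoc)
  also have "\<dots> = ki * z" using assms by (simp add: k_ki sc_simps(2) flip: sc_simps(6))
  finally show ?thesis by simp
qed

lemma ki_x: "ki * x = sc (inverse (q\<^sup>2)) * (x * ki)"
  by (rule ki_weight[OF k_x]) simp

lemma ki_y: "ki * y = sc (q\<^sup>2) * (y * ki)"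
  using ki_weight[OF k_y] by simp

end

context serre_module
begin

text \<open>
  The operator \<open>r\<close> is \<open>u s k\<^sup>-\<^sup>1\<close>; the scalar \<open>u\<close> is dictated by the normalization of its commutator with
  \<open>x\<close>.
\<close>

lemma exists_lowering_partner:
  obtains r where "lin r" "k * r = sc (inverse (q\<^sup>2)) * (r * k)"
    "x * r - r * x = sc (inverse (q - inverse q)) * (k - ki)" "y * r = r * y"
proof -
  define t where "t = q\<^sup>2"
  have t0: "t \<noteq> 0" by (simp add: t_def)
  obtain s where s: "lin s" "s * ki = sc (inverse t) * (ki * s)"
      "s * x - sc t * (x * s) = sc (1 - t) * (1 - k * k)" "s * y = sc (inverse t) * (y * s)"
    using exists_lowering_part unfolding t_def by blast
  define u where "u = t / ((1 - t) * (q - inverse q))"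
  have "1 - t \<noteq> 0" using q_root[of 2] by (simp add: t_def)
  then have u: "u * (inverse t * (1 - t)) = inverse (q - inverse q)"
    unfolding u_def using t0 by (simp add: divide_inverse mult_ac)
  have comm: "f * sc c = sc c * f" if "f \<in> {k, ki, x, y, s}" for f c
    using that s(1) lin_gens by (auto simp: lin_def)
  note comm' = comm[of k] comm[of ki] comm[of x] comm[of y] comm[of s]
  note comm'' = comm'[simplified] comm'[simplified, THEN mult_left_eq]
  define r where "r = sc u * (s * ki)"
  have sc_sc: "sc a * (sc b * f) = sc (a * b) * f" for a b f by (simp add: sc_simps mult.assoc)
  show thesis
  proof
    show "lin r" using s(1) lin_gens by (simp add: r_def)
    have "k * r = sc u * (k * (s * ki))" by (simp add: r_def comm'' mult.assoc)
    also have "\<dots> = sc u * (sc (inverse t) * (k * ki * s))" by (simp add: s(2) comm'' mult.assoc)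
    also have "\<dots> = sc (inverse t) * (r * k)"
      by (simp add: r_def k_ki mult.assoc sc_sc mult.commute)
    finally show "k * r = sc (inverse (q\<^sup>2)) * (r * k)" by (simp add: t_def)
    have sx: "s * x = sc t * (x * s) + sc (1 - t) * (1 - k * k)" using s(3) by (simp add: algebra_simps)
    have "r * x = sc u * (s * (ki * x))" by (simp add: r_def mult.assoc)
    also have "\<dots> = sc u * (sc (inverse t) * (s * x * ki))" by (simp add: ki_x comm'' mult.assoc flip: t_def)
    also have "\<dots> = sc (u * inverse t) * (s * x * ki)" by (rule sc_sc)
    also have "s * x * ki = sc t * (x * (s * ki)) + sc (1 - t) * (ki - k)"
      by (simp add: sx distrib_right left_diff_distrib mult.assoc k_ki)
    also have "sc (u * inverse t) * (sc t * (x * (s * ki)) + sc (1 - t) * (ki - k))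
        = sc u * (x * (s * ki)) + sc (u * (inverse t * (1 - t))) * (ki - k)"
      using t0 by (simp add: distrib_left sc_sc mult.assoc)
    also have "sc u * (x * (s * ki)) = x * r" by (simp add: r_def comm'' mult.assoc)
    finally show "x * r - r * x = sc (inverse (q - inverse q)) * (k - ki)"
      unfolding u by (simp add: right_diff_distrib)
    have "r * y = sc u * (s * (ki * y))" by (simp add: r_def mult.assoc)
    also have "\<dots> = sc u * (sc t * (s * y * ki))" by (simp add: ki_y comm'' mult.assoc flip: t_def)
    also have "\<dots> = sc u * (y * (s * ki))" using t0 by (simp add: s(4) mult.assoc sc_sc)
    finally show "y * r = r * y" by (simp add: r_def comm'' mult.assoc)
  qed
qed

end

text \<open>The operators on an irreducible module of type \<open>1\<close> over the Borel subalgebra.\<close>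

locale borel_module = serre_module scale Basis q d k ki x y
  for scale :: "'f::field \<Rightarrow> 'v::ab_group_add \<Rightarrow> 'v" and Basis q d k ki x y +
  assumes serre_y_x: "serre (sc (q\<^sup>2) + 1 + sc (inverse (q\<^sup>2))) y x = 0"
begin

text \<open>
  The relations are symmetric under exchanging \<open>x\<close> with \<open>y\<close> and \<open>k\<close> with its inverse. The set of eigenvalues
  is closed under inversion, so the spectrum is the same.
\<close>

lemma dual: "serre_module scale Basis q d ki k y x"
proof unfold_locales
  have inv: "(\<exists>v. v \<noteq> 0 \<and> app ki v = scale c v) \<longleftrightarrow> c \<noteq> 0 \<and> (\<exists>v. v \<noteq> 0 \<and> app k v = scale (inverse c) v)" for c
  proof
    assume "\<exists>v. v \<noteq> 0 \<and> app ki v = scale c v"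
    then obtain v where v: "v \<noteq> 0" "app ki v = scale c v" by blast
    then have "app k (app ki v) = scale c (app k v)" by (simp add: lin_scale lin_gens del: app_k_ki)
    then have "v = scale c (app k v)" by simp
    moreover from this v have "c \<noteq> 0" by auto
    ultimately have "app k v = scale (inverse c) v"
      by (metis left_inverse scale_one scale_scale)
    then show "c \<noteq> 0 \<and> (\<exists>v. v \<noteq> 0 \<and> app k v = scale (inverse c) v)" using v \<open>c \<noteq> 0\<close> by blast
  next
    assume "c \<noteq> 0 \<and> (\<exists>v. v \<noteq> 0 \<and> app k v = scale (inverse c) v)"
    then obtain v where v: "c \<noteq> 0" "v \<noteq> 0" "app k v = scale (inverse c) v" by blast
    then have "app ki (app k v) = scale (inverse c) (app ki v)" by (simp add: lin_scale lin_gens del: app_k_ki)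
    then have "v = scale (inverse c) (app ki v)" by simp
    then have "app ki v = scale c v" using v(1)
      by (metis right_inverse scale_one scale_scale)
    then show "\<exists>v. v \<noteq> 0 \<and> app ki v = scale c v" using v by blast
  qed
  show "{c. \<exists>v. v \<noteq> 0 \<and> app ki v = scale c v} = {q powi (2 * int i - int d) | i. i \<le> d}" (is "?L = ?R")
  proof -
    have R: "c \<in> ?R \<longleftrightarrow> c \<noteq> 0 \<and> inverse c \<in> ?R" for c
    proof -
      have *: "inverse c \<in> ?R" if "c \<in> ?R" for c
      proof -
        obtain i where i: "i \<le> d" "c = q powi (2 * int i - int d)" using \<open>c \<in> ?R\<close> by blast
        have "inverse c = q powi (- (2 * int i - int d))" by (simp only: i power_int_minus)
        also have "- (2 * int i - int d) = 2 * int (d - i) - int d" using i(1) by (simp add: of_nat_diff)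
        finally show ?thesis using diff_le_self by blast
      qed
      have "c \<noteq> 0" if "c \<in> ?R" using that q0 by auto
      then show ?thesis using *[of c] *[of "inverse c"] by auto
    qed
    have "c \<in> ?L \<longleftrightarrow> c \<in> ?R" for c
    proof -
      have "c \<in> ?L \<longleftrightarrow> c \<noteq> 0 \<and> inverse c \<in> {c. \<exists>v. v \<noteq> 0 \<and> app k v = scale c v}"
        unfolding mem_Collect_eq by (rule inv)
      then show ?thesis unfolding R[of c] spectrum .
    qed
    then show ?thesis by blast
  qed
  show "W = {0} \<or> W = UNIV"
    if "subspace W" "\<And>f v. f \<in> {ki, k, y, x} \<Longrightarrow> v \<in> W \<Longrightarrow> app f v \<in> W" for W
    using that by (intro irreducible) auto
qed (simp_all add: q0 q_root lin_gens k_ki ki_x ki_y serre_y_x)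

lemma exists_raising_partner:
  obtains l where "lin l" "k * l = sc (q\<^sup>2) * (l * k)"
    "y * l - l * y = sc (inverse (q - inverse q)) * (ki - k)" "x * l = l * x"
proof -
  interpret dual: serre_module scale Basis q d ki k y x by (rule dual)
  obtain l where l: "lin l" "ki * l = sc (inverse (q\<^sup>2)) * (l * ki)"
    "y * l - l * y = sc (inverse (q - inverse q)) * (ki - k)" "x * l = l * x"
    using dual.exists_lowering_partner by blast
  then show thesis using that[of l] dual.ki_weight[OF l(2)] by simp
qed

text \<open>
  The two q-Serre expressions commute with \<open>x\<close> and \<open>y\<close>, and they shift the index of the eigenspaces of \<open>k\<close>
  by \<open>- 2\<close> and by \<open>2\<close>, respectively.
\<close>

lemma serre_partners_zero:
  assumes lin: "lin r" "lin l"
    and r: "k * r = sc (inverse (q\<^sup>2)) * (r * k)"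
      "x * r - r * x = sc (inverse (q - inverse q)) * (k - ki)" "y * r = r * y"
    and l: "k * l = sc (q\<^sup>2) * (l * k)"
      "y * l - l * y = sc (inverse (q - inverse q)) * (ki - k)" "x * l = l * x"
  shows "serre (sc (q\<^sup>2) + 1 + sc (inverse (q\<^sup>2))) r l = 0"
    and "serre (sc (q\<^sup>2) + 1 + sc (inverse (q\<^sup>2))) l r = 0"
proof -
  let ?c = "sc (q\<^sup>2) + 1 + sc (inverse (q\<^sup>2))" and ?h = "sc (inverse (q - inverse q))"
  let ?c' = "sc (inverse (q\<^sup>2)) + 1 + sc (q\<^sup>2)"
  have c': "?c' = ?c" by (simp add: algebra_simps)
  have comm: "f * sc c = sc c * f" if "f \<in> {k, ki, x, y, r, l}" for f c
    using that lin lin_gens by (auto simp: lin_def)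
  note comm' = comm[of k] comm[of ki] comm[of x] comm[of y] comm[of r] comm[of l]
  note comm'' = comm'[simplified]
  have sc_comm: "sc a * sc b = sc b * sc a" for a b
    by (simp add: mult.commute flip: sc_simps(6))
  note wts = r(1) l(1) ki_weight[OF r(1), simplified] ki_weight[OF l(1), simplified]
  have rel: "x * r = r * x + ?h * (k - ki)" "y * l = l * y + ?h * (ki - k)"
    using r(2) l(2) by (simp_all add: algebra_simps)
  have "k * serre ?c r l = sc (inverse (q\<^sup>2)) * sc (inverse (q\<^sup>2)) * (serre ?c r l * k)"
    by (rule serre_weight) (simp_all add: sc_inverse comm'' wts)
  moreover have "k * serre ?c' l r = sc (q\<^sup>2) * sc (q\<^sup>2) * (serre ?c' l r * k)"
    by (rule serre_weight) (simp_all add: sc_inverse comm'' wts)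
  ultimately have weight: "k * serre ?c r l = sc (inverse (q\<^sup>2) ^ 2) * (serre ?c r l * k)"
    "k * serre ?c l r = sc ((q\<^sup>2) ^ 2) * (serre ?c l r * k)"
    by (simp_all only: c' power2_eq_square[of "inverse (q\<^sup>2)"] power2_eq_square[of "q\<^sup>2"] sc_simps)
  show "serre ?c r l = 0"
  proof (rule commuting_weight_shift_zero)
    show "x * serre ?c r l = serre ?c r l * x"
      by (rule serre_commute_partner_fst[where k = k and k' = ki and h = ?h])
        (simp_all add: sc_inverse comm'' sc_comm wts rel l)
    show "y * serre ?c r l = serre ?c r l * y"
      by (rule serre_commute_partner_snd[where k = k and k' = ki and h = ?h])
        (simp_all add: sc_inverse comm'' sc_comm wts rel r)
    show "k * serre ?c r l = sc (q powi (2 * (- 2))) * (serre ?c r l * k)"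
      using weight(1) by (simp add: power_int_def power_inverse flip: power_mult)
  qed (simp_all add: lin serre_def)
  show "serre ?c l r = 0"
  proof (rule commuting_weight_shift_zero)
    show "y * serre ?c l r = serre ?c l r * y"
      by (rule serre_commute_partner_fst[where k = ki and k' = k and h = ?h])
        (simp_all add: sc_inverse comm'' sc_comm wts rel r)
    show "x * serre ?c l r = serre ?c l r * x"
      by (rule serre_commute_partner_snd[where k = ki and k' = k and h = ?h])
        (simp_all add: sc_inverse comm'' sc_comm wts rel l)
    show "k * serre ?c l r = sc (q powi (2 * 2)) * (serre ?c l r * k)"
      using weight(2) by (simp add: power_int_def flip: power_mult)
  qed (simp_all add: lin serre_def)
qed

lemma lowering_partner_unique:
  assumes lin: "lin r" "lin r'"
    and "k * r = sc (inverse (q\<^sup>2)) * (r * k)" "k * r' = sc (inverse (q\<^sup>2)) * (r' * k)"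
    and "x * r - r * x = x * r' - r' * x" "y * r - r * y = y * r' - r' * y"
  shows "r = r'"
proof -
  have "r - r' = 0"
  proof (rule commuting_weight_shift_zero[where n = "- 1"])
    show "x * (r - r') = (r - r') * x" "y * (r - r') = (r - r') * y"
      using assms(5,6) by (simp_all add: algebra_simps) 
    show "k * (r - r') = sc (q powi (2 * - 1)) * ((r - r') * k)"
      using assms(3,4) by (simp add: algebra_simps power_int_def power_inverse)
  qed (use lin in auto)
  then show ?thesis by simp
qed

lemma raising_partner_unique:
  assumes lin: "lin l" "lin l'"
    and "k * l = sc (q\<^sup>2) * (l * k)" "k * l' = sc (q\<^sup>2) * (l' * k)"
    and "x * l - l * x = x * l' - l' * x" "y * l - l * y = y * l' - l' * y"
  shows "l = l'"
proof -
  have "l - l' = 0"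
  proof (rule commuting_weight_shift_zero[where n = 1])
    show "x * (l - l') = (l - l') * x" "y * (l - l') = (l - l') * y"
      using assms(5,6) by (simp_all add: algebra_simps) 
    show "k * (l - l') = sc (q powi (2 * 1)) * ((l - l') * k)"
      using assms(3,4) by (simp add: algebra_simps)
  qed (use lin in auto)
  then show ?thesis by simp
qed

end

section \<open>Extension of the module structure\<close>

lemma qbracket_3:
  assumes "q \<noteq> 0" "q - inverse q \<noteq> (0 :: 'f::field)"
  shows "qbracket q 3 = q\<^sup>2 + 1 + inverse (q\<^sup>2)"
proof -
  have "(q\<^sup>2 + 1 + inverse (q\<^sup>2)) * (q - inverse q) = q ^ 3 - inverse q ^ 3"
    using assms(1) by (simp add: field_simps power2_eq_square power3_eq_cube)
  moreover have "q powi 3 = q ^ 3" "q powi (- 3) = inverse q ^ 3"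
    by (simp_all add: power_int_def)
  ultimately show ?thesis
    using assms(2) by (simp add: qbracket_def field_simps)
qed

context operators
begin

lemma serre_scale:
  assumes "lin f" "lin g" "lin c" "serre c f g = 0"
  shows "serre c (sc a * f) (sc b * g) = 0"
proof (rule add_end_eqI)
  fix v
  have "app (serre c (sc a * f) (sc b * g)) v = scale (a * a * a * b) (app (serre c f g) v)"
    using assms(1-3)
    by (simp add: serre_def power3_eq_cube power2_eq_square lin_scale scale_right_distrib
      scale_right_diff_distrib mult_ac)
  then show "app (serre c (sc a * f) (sc b * g)) v = app 0 v" using assms(4) by simp
qed

end

context borel_module
begin

lemma sc_qbracket_3: "sc (qbracket q 3) = sc (q\<^sup>2) + 1 + sc (inverse (q\<^sup>2))"
  by (simp add: qbracket_3[OF q0 q_minus_inverse_nonzero] sc_simps)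

text \<open>
  The module structure \<open>act'\<close> over the quantum affine algebra extends the given operators: \<open>e\<^sub>0\<^sup>+ = x\<close>,
  \<open>e\<^sub>1\<^sup>+ = y\<close>, \<open>K\<^sub>0 = \<epsilon>\<^sub>0 k\<close> and \<open>K\<^sub>1 = \<epsilon>\<^sub>1 k\<^sup>-\<^sup>1\<close>.
\<close>

definition uq_lift :: "'f \<Rightarrow> 'f \<Rightarrow> ((uq_gen, 'f) free_algebra set \<Rightarrow> 'v \<Rightarrow> 'v) \<Rightarrow> bool"
  where "uq_lift \<epsilon>\<^sub>0 \<epsilon>\<^sub>1 act' \<longleftrightarrow> presented_module scale (uq_rels q) act' \<and>
    (\<forall>v. act' (pgen (uq_rels q) (E Pos Node0)) v = app x v \<and>
      act' (pgen (uq_rels q) (E Pos Node1)) v = app y v \<and>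
      act' (pgen (uq_rels q) (KK Node0)) v = app (sc \<epsilon>\<^sub>0 * k) v \<and>
      act' (pgen (uq_rels q) (KKinv Node0)) v = app (sc \<epsilon>\<^sub>0 * ki) v \<and>
      act' (pgen (uq_rels q) (KK Node1)) v = app (sc \<epsilon>\<^sub>1 * ki) v \<and>
      act' (pgen (uq_rels q) (KKinv Node1)) v = app (sc \<epsilon>\<^sub>1 * k) v)"

text \<open>
  The operators of all generators in terms of partners \<open>r\<close> of \<open>x\<close> and \<open>l\<close> of \<open>y\<close>. The factors \<open>\<epsilon>\<^sub>0\<close> and \<open>\<epsilon>\<^sub>1\<close> at
  \<open>r\<close> and \<open>l\<close> match those of \<open>K\<^sub>0\<close> and \<open>K\<^sub>1\<close> in the commutator relations.
\<close>

fun uq_operator :: "'f \<Rightarrow> 'f \<Rightarrow> 'v add_end \<Rightarrow> 'v add_end \<Rightarrow> uq_gen \<Rightarrow> 'v add_end"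
  where
    "uq_operator \<epsilon>\<^sub>0 \<epsilon>\<^sub>1 r l (E Pos Node0) = x"
  | "uq_operator \<epsilon>\<^sub>0 \<epsilon>\<^sub>1 r l (E Pos Node1) = y"
  | "uq_operator \<epsilon>\<^sub>0 \<epsilon>\<^sub>1 r l (E Neg Node0) = sc \<epsilon>\<^sub>0 * r"
  | "uq_operator \<epsilon>\<^sub>0 \<epsilon>\<^sub>1 r l (E Neg Node1) = sc \<epsilon>\<^sub>1 * l"
  | "uq_operator \<epsilon>\<^sub>0 \<epsilon>\<^sub>1 r l (KK Node0) = sc \<epsilon>\<^sub>0 * k"
  | "uq_operator \<epsilon>\<^sub>0 \<epsilon>\<^sub>1 r l (KKinv Node0) = sc \<epsilon>\<^sub>0 * ki"
  | "uq_operator \<epsilon>\<^sub>0 \<epsilon>\<^sub>1 r l (KK Node1) = sc \<epsilon>\<^sub>1 * ki"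
  | "uq_operator \<epsilon>\<^sub>0 \<epsilon>\<^sub>1 r l (KKinv Node1) = sc \<epsilon>\<^sub>1 * k"

lemma weight_relation_iff:
  assumes "\<epsilon> * \<epsilon> = 1" "lin z"
  shows "sc \<epsilon> * k * z * (sc \<epsilon> * ki) = sc c * z \<longleftrightarrow> k * z = sc c * (z * k)"
    and "sc \<epsilon> * ki * z * (sc \<epsilon> * k) = sc c * z \<longleftrightarrow> ki * z = sc c * (z * ki)"
proof -
  have comm: "f * sc e = sc e * f" if "f \<in> {k, ki, z}" for e f
    using that assms(2) lin_gens by (auto simp: lin_def)
  note comm' = comm[of k, simplified] comm[of ki, simplified] comm[of z, simplified]
  have \<epsilon>: "sc \<epsilon> * sc \<epsilon> = 1" using assms(1) by (simp add: sc_simps(2) flip: sc_simps(6))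
  have 1: "sc \<epsilon> * k * z * (sc \<epsilon> * ki) = k * z * ki"
    by (simp add: mult.assoc comm' comm'[THEN mult_left_eq] \<epsilon>[THEN mult_left_eq])
  have 2: "sc \<epsilon> * ki * z * (sc \<epsilon> * k) = ki * z * k"
    by (simp add: mult.assoc comm' comm'[THEN mult_left_eq] \<epsilon>[THEN mult_left_eq])
  show "sc \<epsilon> * k * z * (sc \<epsilon> * ki) = sc c * z \<longleftrightarrow> k * z = sc c * (z * k)"
    unfolding 1 mult_inverse_eq_iff[OF k_ki] by (simp only: mult.assoc)
  show "sc \<epsilon> * ki * z * (sc \<epsilon> * k) = sc c * z \<longleftrightarrow> ki * z = sc c * (z * ki)"
    unfolding 2 mult_inverse_eq_iff[OF k_ki(2,1)] by (simp only: mult.assoc)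
qed

lemma eval_q_serre:
  assumes "\<And>g. lin (f g)"
  shows "eval f (q_serre q (fgen a) (fgen b)) = serre (sc (q\<^sup>2) + 1 + sc (inverse (q\<^sup>2))) (f a) (f b)"
  using assms
  by (simp add: q_serre_def serre_def eval_add eval_minus eval_mult eval_power flip: sc_qbracket_3)

context
  fixes \<epsilon>\<^sub>0 \<epsilon>\<^sub>1 :: 'f and r l
  assumes \<epsilon>: "\<epsilon>\<^sub>0 * \<epsilon>\<^sub>0 = 1" "\<epsilon>\<^sub>1 * \<epsilon>\<^sub>1 = 1"
    and lin: "lin r" "lin l"
    and r: "k * r = sc (inverse (q\<^sup>2)) * (r * k)"
      "x * r - r * x = sc (inverse (q - inverse q)) * (k - ki)" "y * r = r * y"
    and l: "k * l = sc (q\<^sup>2) * (l * k)"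
      "y * l - l * y = sc (inverse (q - inverse q)) * (ki - k)" "x * l = l * x"
begin

lemma lin_uq_operator: "lin (uq_operator \<epsilon>\<^sub>0 \<epsilon>\<^sub>1 r l g)"
  by (cases "(\<epsilon>\<^sub>0, \<epsilon>\<^sub>1, r, l, g)" rule: uq_operator.cases) (simp_all add: lin lin_gens)

lemma sc_\<epsilon>: "sc \<epsilon>\<^sub>0 * sc \<epsilon>\<^sub>0 = 1" "sc \<epsilon>\<^sub>1 * sc \<epsilon>\<^sub>1 = 1"
  using \<epsilon> by (simp_all add: sc_simps(2) flip: sc_simps(6))

lemma eval_uq_rels:
  assumes "a \<in> uq_rels q"
  shows "eval (uq_operator \<epsilon>\<^sub>0 \<epsilon>\<^sub>1 r l) a = 0"
proof -
  let ?f = "uq_operator \<epsilon>\<^sub>0 \<epsilon>\<^sub>1 r l"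
  let ?c = "sc (q\<^sup>2) + 1 + sc (inverse (q\<^sup>2))"
  have comm: "f * sc e = sc e * f" if "f \<in> {k, ki, x, y, r, l}" for e f
    using that lin lin_gens by (auto simp: lin_def)
  note comm' = comm[of k, simplified] comm[of ki, simplified] comm[of x, simplified]
    comm[of y, simplified] comm[of r, simplified] comm[of l, simplified]
  note comm'' = comm' comm'[THEN mult_left_eq]
  note ev = eval_add eval_minus eval_mult lin_uq_operator
  have sc_comm: "sc a * sc b = sc b * sc a" for a b
    by (simp add: mult.commute flip: sc_simps(6))
  have sc_left_comm: "sc a * (sc b * c) = sc b * (sc a * c)" for a b c
    by (rule mult_left_eq[OF sc_comm, unfolded mult.assoc])
  have KK_KKinv: "?f (KK i) * ?f (KKinv i) = 1" "?f (KKinv i) * ?f (KK i) = 1" for i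
    by (cases i; simp add: mult.assoc comm'' k_ki sc_\<epsilon>)+
  have KK: "?f (KK Node0) * ?f (KK Node1) = ?f (KK Node1) * ?f (KK Node0)"
    by (simp add: mult.assoc comm'' k_ki sc_comm)
  have ki: "ki * r = sc (q\<^sup>2) * (r * ki)" "ki * l = sc (inverse (q\<^sup>2)) * (l * ki)"
    using ki_weight[OF r(1)] ki_weight[OF l(1)] by simp_all
  have powi: "q powi 2 = q\<^sup>2" "q powi (- 2) = inverse (q\<^sup>2)"
    by (simp_all add: power_int_def power_inverse)
  have weight_same: "?f (KK i) * ?f (E s i) * ?f (KKinv i) = sc (q powi (2 * sign_int s)) * ?f (E s i)" for i s
    by (cases i; cases s)
      (simp_all add: weight_relation_iff \<epsilon> lin lin_gens powi, simp_all add: comm'' mult.assoc sc_left_comm k_x ki_y r l ki)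
  have weight_other: "?f (KK i) * ?f (E s j) * ?f (KKinv i) = sc (q powi (- 2 * sign_int s)) * ?f (E s j)"
    if "i \<noteq> j" for i j s
    using that by (cases i; cases j; cases s)
      (simp_all add: weight_relation_iff \<epsilon> lin lin_gens powi, simp_all add: comm'' mult.assoc sc_left_comm k_y ki_x r l ki)
  have bracket: "?f (E Pos i) * ?f (E Neg i) - ?f (E Neg i) * ?f (E Pos i)
      = sc (inverse (q - inverse q)) * (?f (KK i) - ?f (KKinv i))" for i
    using arg_cong[OF r(2), of "\<lambda>f. sc \<epsilon>\<^sub>0 * f"] arg_cong[OF l(2), of "\<lambda>f. sc \<epsilon>\<^sub>1 * f"]
    by (cases i) (simp_all add: comm'' mult.assoc right_diff_distrib sc_comm sc_left_comm)
  have commute: "?f (E Pos Node0) * ?f (E Neg Node1) = ?f (E Neg Node1) * ?f (E Pos Node0)"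
    "?f (E Neg Node0) * ?f (E Pos Node1) = ?f (E Pos Node1) * ?f (E Neg Node0)"
    by (simp_all add: comm'' mult.assoc r l)
  have serre: "serre ?c (?f (E s i)) (?f (E s j)) = 0" if "i \<noteq> j" for i j s
    using that by (cases i; cases j; cases s)
      (simp_all add: serre_x_y serre_y_x serre_scale serre_partners_zero r l lin)
  show ?thesis
    using assms unfolding uq_rels_def
    by (elim UnE CollectE exE conjE insertE emptyE)
      (simp_all add: ev comm_def KK_KKinv KK[simplified] weight_same weight_other[simplified] bracket commute[simplified]
        eval_q_serre serre)
qed

lemma uq_lift_exists: "\<exists>act'. uq_lift \<epsilon>\<^sub>0 \<epsilon>\<^sub>1 act'"
proof -
  obtain act' where "presented_module scale (uq_rels q) act'"
    "\<And>g v. act' (pgen (uq_rels q) g) v = app (uq_operator \<epsilon>\<^sub>0 \<epsilon>\<^sub>1 r l g) v"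
    using module_of_operators[OF lin_uq_operator eval_uq_rels] by blast
  then show ?thesis by (auto simp: uq_lift_def)
qed

text \<open>
  In every extension, \<open>e\<^sub>0\<^sup>-\<close> and \<open>e\<^sub>1\<^sup>-\<close> are the partners up to the factors \<open>\<epsilon>\<^sub>0\<close> and \<open>\<epsilon>\<^sub>1\<close>, because they satisfy the
  relations that determine the partners uniquely.
\<close>

lemma uq_lift_generators:
  assumes "uq_lift \<epsilon>\<^sub>0 \<epsilon>\<^sub>1 act'"
  shows "act' (pgen (uq_rels q) g) v = app (uq_operator \<epsilon>\<^sub>0 \<epsilon>\<^sub>1 r l g) v"
proof -
  have M: "presented_module scale (uq_rels q) act'" using assms by (simp add: uq_lift_def)
  define \<rho> where "\<rho> = rep (uq_rels q) act'"
  have app_\<rho>: "app (\<rho> a) v = act' (coset_of (uq_rels q) a) v" for a v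
    by (simp add: \<rho>_def app_rep M)
  have lin_\<rho>: "lin (\<rho> a)" for a by (simp add: \<rho>_def lin_rep M)
  have pos: "\<rho> (fgen (E Pos Node0)) = x" "\<rho> (fgen (E Pos Node1)) = y"
    "\<rho> (fgen (KK Node0)) = sc \<epsilon>\<^sub>0 * k" "\<rho> (fgen (KKinv Node0)) = sc \<epsilon>\<^sub>0 * ki"
    "\<rho> (fgen (KK Node1)) = sc \<epsilon>\<^sub>1 * ki" "\<rho> (fgen (KKinv Node1)) = sc \<epsilon>\<^sub>1 * k"
    using assms by (auto simp: uq_lift_def app_\<rho> intro!: add_end_eqI)
  define e0 e1 where "e0 = \<rho> (fgen (E Neg Node0))" and "e1 = \<rho> (fgen (E Neg Node1))"
  have lin_e: "lin e0" "lin e1" by (simp_all add: e0_def e1_def lin_\<rho>)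
  note \<rho>_hom = rep_add[OF M, folded \<rho>_def] rep_minus[OF M, folded \<rho>_def] rep_mult[OF M, folded \<rho>_def]
    rep_fconst[OF M, folded \<rho>_def] rep_one[OF M, folded \<rho>_def]
  have rel: "\<rho> a = 0" if "a \<in> uq_rels q" for a using rep_rel[OF M that] by (simp add: \<rho>_def)
  have powi: "q powi 2 = q\<^sup>2" "q powi (- 2) = inverse (q\<^sup>2)"
    by (simp_all add: power_int_def power_inverse)
  have "fgen (KK Node0) * fgen (E Neg Node0) * fgen (KKinv Node0)
      - fconst (q powi (2 * sign_int Neg)) * fgen (E Neg Node0) \<in> uq_rels q"
    unfolding uq_rels_def by blast
  from rel[OF this] have e0_wt: "k * e0 = sc (inverse (q\<^sup>2)) * (e0 * k)"
    by (simp add: \<rho>_hom pos powi weight_relation_iff \<epsilon> lin_e flip: e0_def)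
  have "fgen (KK Node0) * fgen (E Neg Node1) * fgen (KKinv Node0)
      - fconst (q powi (- 2 * sign_int Neg)) * fgen (E Neg Node1) \<in> uq_rels q"
    unfolding uq_rels_def by blast
  from rel[OF this] have e1_wt: "k * e1 = sc (q\<^sup>2) * (e1 * k)"
    by (simp add: \<rho>_hom pos powi weight_relation_iff \<epsilon> lin_e flip: e1_def)
  have "comm (fgen (E Pos i)) (fgen (E Neg i))
      - fconst (inverse (q - inverse q)) * (fgen (KK i) - fgen (KKinv i)) \<in> uq_rels q" for i
    unfolding uq_rels_def by blast
  from rel[OF this[of Node0]] rel[OF this[of Node1]]
  have e0_x: "x * e0 - e0 * x = sc (inverse (q - inverse q)) * (sc \<epsilon>\<^sub>0 * (k - ki))"
    and e1_y: "y * e1 - e1 * y = sc (inverse (q - inverse q)) * (sc \<epsilon>\<^sub>1 * (ki - k))"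
    by (simp_all add: \<rho>_hom pos comm_def right_diff_distrib flip: e0_def e1_def)
  have "comm (fgen (E Pos Node0)) (fgen (E Neg Node1)) \<in> uq_rels q"
    "comm (fgen (E Neg Node0)) (fgen (E Pos Node1)) \<in> uq_rels q"
    unfolding uq_rels_def by blast+
  from this[THEN rel] have e1_x: "x * e1 - e1 * x = 0" and e0_y: "y * e0 - e0 * y = 0"
    by (simp_all add: \<rho>_hom pos comm_def flip: e0_def e1_def)
  have comm: "f * sc e = sc e * f" if "f \<in> {k, ki, x, y, r, l}" for e f
    using that lin lin_gens by (auto simp: lin_def)
  note comm' = comm[of k, simplified] comm[of ki, simplified] comm[of x, simplified]
    comm[of y, simplified] comm[of r, simplified] comm[of l, simplified]
  note comm'' = comm' comm'[THEN mult_left_eq]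
  have sc_comm: "sc a * (sc b * c) = sc b * (sc a * c)" for a b c
    by (simp add: mult.commute flip: mult.assoc sc_simps(6))
  have "e0 = sc \<epsilon>\<^sub>0 * r"
  proof (rule lowering_partner_unique)
    show "k * (sc \<epsilon>\<^sub>0 * r) = sc (inverse (q\<^sup>2)) * (sc \<epsilon>\<^sub>0 * r * k)"
      by (simp add: comm'' r mult.assoc sc_comm[of \<epsilon>\<^sub>0])
    show "x * e0 - e0 * x = x * (sc \<epsilon>\<^sub>0 * r) - sc \<epsilon>\<^sub>0 * r * x"
      unfolding e0_x sc_comm[of _ \<epsilon>\<^sub>0] r(2)[symmetric] by (simp add: comm'' right_diff_distrib mult.assoc)
    show "y * e0 - e0 * y = y * (sc \<epsilon>\<^sub>0 * r) - sc \<epsilon>\<^sub>0 * r * y"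
      unfolding e0_y by (simp add: comm'' mult.assoc r)
  qed (simp_all add: lin_e lin e0_wt)
  moreover have "e1 = sc \<epsilon>\<^sub>1 * l"
  proof (rule raising_partner_unique)
    show "k * (sc \<epsilon>\<^sub>1 * l) = sc (q\<^sup>2) * (sc \<epsilon>\<^sub>1 * l * k)"
      by (simp add: comm'' l mult.assoc sc_comm[of \<epsilon>\<^sub>1])
    show "y * e1 - e1 * y = y * (sc \<epsilon>\<^sub>1 * l) - sc \<epsilon>\<^sub>1 * l * y"
      unfolding e1_y sc_comm[of _ \<epsilon>\<^sub>1] l(2)[symmetric] by (simp add: comm'' right_diff_distrib mult.assoc)
    show "x * e1 - e1 * x = x * (sc \<epsilon>\<^sub>1 * l) - sc \<epsilon>\<^sub>1 * l * x"
      unfolding e1_x by (simp add: comm'' mult.assoc l)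
  qed (simp_all add: lin_e lin e1_wt)
  ultimately have "\<rho> (fgen g) = uq_operator \<epsilon>\<^sub>0 \<epsilon>\<^sub>1 r l g"
    by (cases "(\<epsilon>\<^sub>0, \<epsilon>\<^sub>1, r, l, g)" rule: uq_operator.cases) (simp_all add: pos e0_def e1_def)
  then show ?thesis using app_\<rho>[of "fgen g" v] by simp
qed

end

lemma uq_lift_ex1:
  assumes "\<epsilon>\<^sub>0 * \<epsilon>\<^sub>0 = 1" "\<epsilon>\<^sub>1 * \<epsilon>\<^sub>1 = 1"
  shows "\<exists>!act'. uq_lift \<epsilon>\<^sub>0 \<epsilon>\<^sub>1 act'"
proof -
  obtain r where r: "lin r" "k * r = sc (inverse (q\<^sup>2)) * (r * k)"
    "x * r - r * x = sc (inverse (q - inverse q)) * (k - ki)" "y * r = r * y"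
    using exists_lowering_partner by blast
  obtain l where l: "lin l" "k * l = sc (q\<^sup>2) * (l * k)"
    "y * l - l * y = sc (inverse (q - inverse q)) * (ki - k)" "x * l = l * x"
    using exists_raising_partner by blast
  show ?thesis
  proof (rule ex_ex1I)
    show "\<exists>act'. uq_lift \<epsilon>\<^sub>0 \<epsilon>\<^sub>1 act'"
      using uq_lift_exists[OF assms r(1) l(1) r(2-4) l(2-4)] .
    fix act1 act2 assume lift: "uq_lift \<epsilon>\<^sub>0 \<epsilon>\<^sub>1 act1" "uq_lift \<epsilon>\<^sub>0 \<epsilon>\<^sub>1 act2"
    note gens = uq_lift_generators[OF assms r(1) l(1) r(2-4) l(2-4)]
    show "act1 = act2"
    proof (rule presented_module_eqI)
      show "presented_module scale (uq_rels q) act1" "presented_module scale (uq_rels q) act2"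
        using lift by (simp_all add: uq_lift_def)
      show "act1 (pgen (uq_rels q) g) v = act2 (pgen (uq_rels q) g) v" for g v
        by (simp only: gens[OF lift(1)] gens[OF lift(2)])
    qed
  qed
qed

lemma uq_lift_irreducible:
  assumes \<epsilon>: "\<epsilon>\<^sub>0 * \<epsilon>\<^sub>0 = 1" and lift: "uq_lift \<epsilon>\<^sub>0 \<epsilon>\<^sub>1 act'"
  shows "irreducible_module scale (uq_rels q) act'"
  unfolding irreducible_module_def
proof (intro conjI allI impI)
  show "presented_module scale (uq_rels q) act'" using lift by (simp add: uq_lift_def)
  show "(UNIV :: 'v set) \<noteq> {0}" using eig_k_nonzero[of 0] by auto
  fix W assume W: "subspace W \<and> (\<forall>a\<in>carrier (presented (uq_rels q)). act' a ` W \<subseteq> W)"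
  then have inv: "act' (pgen (uq_rels q) g) v \<in> W" if "v \<in> W" for g v
    using that coset_of_in_carrier by blast
  show "W = {0} \<or> W = UNIV"
  proof (rule irreducible)
    fix f v assume f: "f \<in> {k, ki, x, y}" and v: "v \<in> W"
    have "scale \<epsilon>\<^sub>0 (act' (pgen (uq_rels q) g) v) \<in> W" for g
      using W inv[OF v] by (simp add: subspace_scale)
    from this[of "KK Node0"] this[of "KKinv Node0"] inv[OF v, of "E Pos Node0"] inv[OF v, of "E Pos Node1"]
    have "app k v \<in> W" "app ki v \<in> W" "app x v \<in> W" "app y v \<in> W"
      using lift \<epsilon> by (simp_all add: uq_lift_def)
    then show "app f v \<in> W" using f by auto
  qed (use W in blast)
qed

lemma uq_lift_type:
  assumes \<epsilon>: "\<epsilon>\<^sub>0 \<in> {1, - 1}" "\<epsilon>\<^sub>1 \<in> {1, - 1}" and lift: "uq_lift \<epsilon>\<^sub>0 \<epsilon>\<^sub>1 act'"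
  shows "uq_type q scale act' \<epsilon>\<^sub>0 \<epsilon>\<^sub>1"
proof -
  have \<epsilon>0: "\<epsilon>\<^sub>0 * \<epsilon>\<^sub>0 = 1" using \<epsilon> by auto
  have "eigenvalues scale (act' (pgen (uq_rels q) (KK Node0))) = {\<epsilon>\<^sub>0 * q powi (2 * int i - int d) | i. i \<le> d}"
  proof -
    have iff: "scale \<epsilon>\<^sub>0 (app k v) = scale c v \<longleftrightarrow> app k v = scale (\<epsilon>\<^sub>0 * c) v" for c v
      using \<epsilon>0 by (metis scale_one scale_scale)
    have "c \<in> eigenvalues scale (act' (pgen (uq_rels q) (KK Node0))) \<longleftrightarrow>
        \<epsilon>\<^sub>0 * c \<in> {c. \<exists>v. v \<noteq> 0 \<and> app k v = scale c v}" for c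
      using lift by (simp add: uq_lift_def eigenvalues_def iff)
    moreover have "\<epsilon>\<^sub>0 * c \<in> {c. \<exists>v. v \<noteq> 0 \<and> app k v = scale c v} \<longleftrightarrow> c \<in> {\<epsilon>\<^sub>0 * q powi (2 * int i - int d) | i. i \<le> d}" for c
      unfolding spectrum using \<epsilon>0 by (auto simp: mult.assoc[symmetric]) (metis mult.assoc mult_1)
    ultimately show ?thesis by blast
  qed
  moreover have "act' (pgen (uq_rels q) (KK Node0)) (act' (pgen (uq_rels q) (KK Node1)) v) = scale (\<epsilon>\<^sub>0 * \<epsilon>\<^sub>1) v" for v
    using lift by (simp add: uq_lift_def lin_scale lin_gens)
  ultimately show ?thesis using \<epsilon> by (auto simp: uq_type_def)
qed

end

theorem theorem1p16:
  fixes q \<alpha> \<epsilon>\<^sub>0 \<epsilon>\<^sub>1 :: "'f::alg_closed_field"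
    and scale :: "'f \<Rightarrow> 'v::ab_group_add \<Rightarrow> 'v"
    and B :: "'v set"
    and act :: "(uge0_gen, 'f) free_algebra set \<Rightarrow> 'v \<Rightarrow> 'v"
  assumes "q \<noteq> 0" and "\<And>n::nat. n > 0 \<Longrightarrow> q ^ n \<noteq> 1"
    and "finite_dimensional_vector_space scale B"
    and "irreducible_module scale (uge0_rels q) act"
    and "uge0_type q scale act \<alpha>"
    and "\<epsilon>\<^sub>0 \<in> {1, - 1}" and "\<epsilon>\<^sub>1 \<in> {1, - 1}"
  shows "(\<exists>!act'. uq_extends q scale act \<alpha> \<epsilon>\<^sub>0 \<epsilon>\<^sub>1 act') \<and>
    (\<forall>act'. uq_extends q scale act \<alpha> \<epsilon>\<^sub>0 \<epsilon>\<^sub>1 act' \<longrightarrow>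
      irreducible_module scale (uq_rels q) act' \<and> uq_type q scale act' \<epsilon>\<^sub>0 \<epsilon>\<^sub>1)"
proof -
  interpret finite_dimensional_vector_space scale B by fact
  interpret operators scale by unfold_locales
  define \<rho> where "\<rho> = rep (uge0_rels q) act"
  have M: "presented_module scale (uge0_rels q) act"
    using assms(4) by (simp add: irreducible_module_def)
  have app_\<rho>: "app (\<rho> a) v = act (coset_of (uge0_rels q) a) v" for a v
    by (simp add: \<rho>_def app_rep M)
  have lin_\<rho>: "lin (\<rho> a)" for a by (simp add: \<rho>_def lin_rep M)
  note \<rho>_hom = rep_add[OF M, folded \<rho>_def] rep_minus[OF M, folded \<rho>_def] rep_mult[OF M, folded \<rho>_def]
    rep_fconst[OF M, folded \<rho>_def] rep_one[OF M, folded \<rho>_def] rep_power[OF M, folded \<rho>_def]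
  have rel: "\<rho> a = 0" if "a \<in> uge0_rels q" for a using rep_rel[OF M that] by (simp add: \<rho>_def)
  have \<alpha>: "\<alpha> \<noteq> 0" using assms(5) by (simp add: uge0_type_def)
  obtain d where d: "eigenvalues scale (act (pgen (uge0_rels q) K)) = {\<alpha> * q powi (2 * int i - int d) | i. i \<le> d}"
    using assms(5) by (auto simp: uge0_type_def)
  \<comment> \<open>The scalars turn the type \<open>\<alpha>\<close> into \<open>1\<close>.\<close>
  define k ki x y where "k = sc (inverse \<alpha>) * \<rho> (fgen K)" and "ki = sc \<alpha> * \<rho> (fgen Kinv)"
    and "x = \<rho> (fgen R)" and "y = \<rho> (fgen L)"
  have lin: "lin k" "lin ki" "lin x" "lin y" by (simp_all add: k_def ki_def x_def y_def lin_\<rho>)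
  have comm: "\<rho> a * sc c = sc c * \<rho> a" for a c using lin_\<rho> by (auto simp: lin_def)
  have sc_\<alpha>: "sc \<alpha> * sc (inverse \<alpha>) = 1" "sc (inverse \<alpha>) * sc \<alpha> = 1"
    using \<alpha> by (simp_all add: sc_simps(2) flip: sc_simps(6))
  have powi: "q powi 2 = q\<^sup>2" "q powi (- 2) = inverse (q\<^sup>2)"
    by (simp_all add: power_int_def power_inverse)
  have K_Kinv: "\<rho> (fgen K) * \<rho> (fgen Kinv) = 1" "\<rho> (fgen Kinv) * \<rho> (fgen K) = 1"
    using rel[of "fgen K * fgen Kinv - 1"] rel[of "fgen Kinv * fgen K - 1"]
    by (simp_all add: uge0_rels_def \<rho>_hom)
  have K_R: "\<rho> (fgen K) * x * \<rho> (fgen Kinv) = sc (q\<^sup>2) * x"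
    and K_L: "\<rho> (fgen K) * y * \<rho> (fgen Kinv) = sc (inverse (q\<^sup>2)) * y"
    using rel[of "fgen K * fgen R * fgen Kinv - fconst (q powi 2) * fgen R"]
      rel[of "fgen K * fgen L * fgen Kinv - fconst (q powi (- 2)) * fgen L"]
    by (simp_all add: uge0_rels_def \<rho>_hom powi x_def y_def)
  have K_x: "\<rho> (fgen K) * x = sc (q\<^sup>2) * (x * \<rho> (fgen K))"
    and K_y: "\<rho> (fgen K) * y = sc (inverse (q\<^sup>2)) * (y * \<rho> (fgen K))"
    using K_R K_L unfolding mult_inverse_eq_iff[OF K_Kinv] by (simp_all only: mult.assoc)
  have q_inv: "q - inverse q \<noteq> 0"
  proof
    assume "q - inverse q = 0"
    then have "q ^ 2 = 1" using assms(1) by (simp add: power2_eq_square field_simps)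
    then show False using assms(2)[of 2] by simp
  qed
  have sc_bracket: "sc (q\<^sup>2) + 1 + sc (inverse (q\<^sup>2)) = sc (qbracket q 3)"
    by (simp add: qbracket_3[OF assms(1) q_inv] sc_simps)
  interpret borel_module scale B q d k ki x y
  proof unfold_locales
    show "k * ki = 1" "ki * k = 1"
      by (simp_all add: k_def ki_def mult.assoc comm comm[THEN mult_left_eq] K_Kinv sc_\<alpha>)
    show "k * x = sc (q\<^sup>2) * (x * k)" "k * y = sc (inverse (q\<^sup>2)) * (y * k)"
      using K_x K_y by (simp_all add: k_def x_def y_def mult.assoc comm comm[THEN mult_left_eq])
        (simp_all add: mult.commute flip: mult.assoc sc_simps(6))
    show "serre (sc (q\<^sup>2) + 1 + sc (inverse (q\<^sup>2))) x y = 0" "serre (sc (q\<^sup>2) + 1 + sc (inverse (q\<^sup>2))) y x = 0"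
      using rel[of "q_serre q (fgen R) (fgen L)"] rel[of "q_serre q (fgen L) (fgen R)"]
      by (simp_all add: uge0_rels_def q_serre_def serre_def \<rho>_hom sc_bracket x_def y_def)
    show "{c. \<exists>v. v \<noteq> 0 \<and> app k v = scale c v} = {q powi (2 * int i - int d) | i. i \<le> d}"
    proof -
      have iff: "scale (inverse \<alpha>) w = scale c v \<longleftrightarrow> w = scale (\<alpha> * c) v" for c v w
        using \<alpha> by (metis (no_types) left_inverse right_inverse scale_one scale_scale)
      have "c \<in> {c. \<exists>v. v \<noteq> 0 \<and> app k v = scale c v} \<longleftrightarrow>
          \<alpha> * c \<in> eigenvalues scale (act (pgen (uge0_rels q) K))" for c
        by (simp add: k_def app_\<rho> iff eigenvalues_def)
      moreover have "\<alpha> * c \<in> eigenvalues scale (act (pgen (uge0_rels q) K)) \<longleftrightarrow> c \<in> {q powi (2 * int i - int d) | i. i \<le> d}" for c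
        unfolding d using \<alpha> by auto
      ultimately show ?thesis by blast
    qed
    show "W = {0} \<or> W = UNIV"
      if W: "subspace W" and inv: "\<And>f v. f \<in> {k, ki, x, y} \<Longrightarrow> v \<in> W \<Longrightarrow> app f v \<in> W" for W
    proof -
      have "act (pgen (uge0_rels q) g) v \<in> W" if v: "v \<in> W" for g v
      proof -
        have "scale \<alpha> (app k v) \<in> W" "scale (inverse \<alpha>) (app ki v) \<in> W" "app x v \<in> W" "app y v \<in> W"
          using inv[OF _ v] W by (auto intro: subspace_scale)
        then show ?thesis using \<alpha> by (cases g) (simp_all add: k_def ki_def x_def y_def app_\<rho>)
      qed
      then have "\<forall>a\<in>carrier (presented (uge0_rels q)). act a ` W \<subseteq> W"
        using rep_invariant[OF M W] by blast
      then show ?thesis using assms(4) W by (simp add: irreducible_module_def)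
    qed
  qed (simp_all add: assms(1,2) lin)
  have extends_iff: "uq_extends q scale act \<alpha> \<epsilon>\<^sub>0 \<epsilon>\<^sub>1 act' \<longleftrightarrow> uq_lift \<epsilon>\<^sub>0 \<epsilon>\<^sub>1 act'" for act'
  proof -
    have "app k v = scale (inverse \<alpha>) (act (pgen (uge0_rels q) K) v)"
      "app ki v = scale \<alpha> (act (pgen (uge0_rels q) Kinv) v)"
      "app x v = act (pgen (uge0_rels q) R) v" "app y v = act (pgen (uge0_rels q) L) v" for v
      by (simp_all add: k_def ki_def x_def y_def app_\<rho>)
    then show ?thesis by (simp add: uq_extends_def uq_lift_def)
  qed
  have \<epsilon>: "\<epsilon>\<^sub>0 * \<epsilon>\<^sub>0 = 1" "\<epsilon>\<^sub>1 * \<epsilon>\<^sub>1 = 1" using assms(6,7) by auto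
  show ?thesis
    unfolding extends_iff
    using uq_lift_ex1[OF \<epsilon>] uq_lift_irreducible[OF \<epsilon>(1)] uq_lift_type[OF assms(6,7)] by blast
qed

end
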